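(* There is a deterministic algorithm which, given two matroids $\mathcal{M}_1=(V,\mathcal{I}_1)$ and $\mathcal{M}_2=(V,\mathcal{I}_2)$ on the same ground set $V$ with $|V|=n$ (accessed only through independence oracles) and a parameter $\varepsilon>0$, finds a common independent set $S\in\mathcal{I}_1\cap\mathcal{I}_2$ with $|S|\ge(1-\varepsilon)r$, using $O\!\left(\frac{n\sqrt{r\log r}}{\varepsilon}\right)$ independence queries, where $r$ is the maximum cardinality of a set in $\mathcal{I}_1\cap\mathcal{I}_2$.
   Context: A matroid is a pair $\mathcal{M}=(V,\mathcal{I})$ with $V$ a finite ground set and $\mathcal{I}\subseteq 2^V$ a nonempty family of "independent sets" that is downward closed and satisfies the exchange property (if $S,S'\in\mathcal{I}$ and $|S|>|S'|$ then there is $x\in S\setminus S'$ with $S'\cup\{x\}\in\mathcal{I}$). The algorithm accesses the matroids only via independence queries: for a set $S\subseteq V$ and $i\in\{1,2\}$, a query answers whether $S\in\mathcal{I}_i$. Query complexity counts the number of such queries. A common independent set is a set in $\mathcal{I}_1\cap\mathcal{I}_2$; $r$ denotes the size of a largest common independent set. *)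

theory Defs
  imports Complex_Main
begin

definition matroid :: "'a set \<Rightarrow> 'a set set \<Rightarrow> bool" where
  "matroid V \<I> \<longleftrightarrow>
     finite V \<and> \<I> \<subseteq> Pow V \<and> \<I> \<noteq> {} \<and>
     (\<forall>S\<in>\<I>. \<forall>T. T \<subseteq> S \<longrightarrow> T \<in> \<I>) \<and>
     (\<forall>S\<in>\<I>. \<forall>S'\<in>\<I>. card S > card S' \<longrightarrow> (\<exists>x\<in>S - S'. S' \<union> {x} \<in> \<I>))"

definition max_common_indep :: "'a set set \<Rightarrow> 'a set set \<Rightarrow> nat" where
  "max_common_indep \<I>\<^sub>1 \<I>\<^sub>2 = Max (card ` (\<I>\<^sub>1 \<inter> \<I>\<^sub>2))"

(* A deterministic adaptive algorithm with access to two independence oracles is a decision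
   tree: the next query, or the final answer, depends only on the answers received so far.
   As a datatype value the tree is well-founded, so every run makes finitely many queries.
   A complexity constant claimed for all ground sets in 'a is uniform in their size as soon as 'a is
   infinite; 'a = nat covers every finite ground set up to renaming of its elements. *)
datatype 'a query_tree =
    Output "'a set"
  | Query1 "'a set" "bool \<Rightarrow> 'a query_tree"
  | Query2 "'a set" "bool \<Rightarrow> 'a query_tree"

primrec queries_within :: "'a set \<Rightarrow> 'a query_tree \<Rightarrow> bool" where
  "queries_within V (Output S) \<longleftrightarrow> True"
| "queries_within V (Query1 S k) \<longleftrightarrow> S \<subseteq> V \<and> (\<forall>b. queries_within V (k b))"
| "queries_within V (Query2 S k) \<longleftrightarrow> S \<subseteq> V \<and> (\<forall>b. queries_within V (k b))"

primrec run :: "'a set set \<Rightarrow> 'a set set \<Rightarrow> 'a query_tree \<Rightarrow> 'a set" where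
  "run \<I>\<^sub>1 \<I>\<^sub>2 (Output S) = S"
| "run \<I>\<^sub>1 \<I>\<^sub>2 (Query1 S k) = run \<I>\<^sub>1 \<I>\<^sub>2 (k (S \<in> \<I>\<^sub>1))"
| "run \<I>\<^sub>1 \<I>\<^sub>2 (Query2 S k) = run \<I>\<^sub>1 \<I>\<^sub>2 (k (S \<in> \<I>\<^sub>2))"

primrec num_queries :: "'a set set \<Rightarrow> 'a set set \<Rightarrow> 'a query_tree \<Rightarrow> nat" where
  "num_queries \<I>\<^sub>1 \<I>\<^sub>2 (Output S) = 0"
| "num_queries \<I>\<^sub>1 \<I>\<^sub>2 (Query1 S k) = Suc (num_queries \<I>\<^sub>1 \<I>\<^sub>2 (k (S \<in> \<I>\<^sub>1)))"
| "num_queries \<I>\<^sub>1 \<I>\<^sub>2 (Query2 S k) = Suc (num_queries \<I>\<^sub>1 \<I>\<^sub>2 (k (S \<in> \<I>\<^sub>2)))"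

(* n * sqrt (r * log r) / \<epsilon>, with r replaced by max 2 r.  For r <= 1 the formula itself would be 0,
   but telling r = 0 from r = 1 needs queries; for r >= 2 nothing is changed. *)
definition query_bound :: "nat \<Rightarrow> nat \<Rightarrow> real \<Rightarrow> real" where
  "query_bound n r \<epsilon> = real n * sqrt (real (max 2 r) * ln (real (max 2 r))) / \<epsilon>"

end

theory Submission
  imports Defs "HOL-Analysis.Harmonic_Numbers"
begin

text \<open>
  Two algorithms cover the range of \<open>\<epsilon>\<close>; a greedy common independent set, of size between \<open>r / 2\<close> and
  \<open>r\<close>, tells which one to use.

  If \<open>1 / \<epsilon> \<le> sqrt (r log r)\<close>, an auction with \<open>O(1 / \<epsilon>)\<close> price levels is run. The elements have integer prices;
  the solution \<open>S\<close> is a maximum-price basis of the elements of positive price in the second matroid and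
  sits inside a minimum-price basis of the first one. In each round the elements that would enlarge \<open>S\<close> in the
  first matroid offer one more than their price, and a maximal compatible set of offers is accepted.
  As long as that basis has at least \<open>\<epsilon> r / 4\<close> more elements than \<open>S\<close>, a potential bounded by twice the number
  of levels times the rank drops by as much per round, so \<open>O(1 / \<epsilon>\<^sup>2)\<close> rounds of \<open>O(n)\<close> queries suffice. Weak duality over the price thresholds shows
  that the final \<open>S\<close> is almost maximum.

  Otherwise \<open>n sqrt (r log r) / \<epsilon>\<close> exceeds \<open>n r log r\<close>, which pays for the exact augmenting path algorithm: a
  shortest augmenting path for \<open>S\<close> has length \<open>O(r / (r - |S|))\<close>, a breadth-first search costs \<open>O(n)\<close>
  queries per layer plus a binary search for each element of \<open>S\<close>, and the lengths sum up harmonically.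
\<close>

section \<open>Rank and closure\<close>

text \<open>The target is the geometric mean of two costs, \<open>n / \<epsilon>^2\<close> for the
  auction and \<open>n r log r\<close> for augmentation, so the smaller of the two always meets it.
  This is where the square root comes from. As \<open>r\<close> is unknown, the branch is chosen by
  the greedy size, which changes constants only. The auction needs contracted matroids: an offer
  must be independent in the first matroid over all elements of lower bid. Contractions are never
  built. They are expressed through closure, and a query replaces the contracted set by an
  independent set that spans it. Losing offers are treated asymmetrically: a refusal by the second
  matroid raises the price for good, a refusal by the first alone leaves it unchanged. Both rank
  sums of the potential then move in one direction only. For augmentation the classical obstacle is
  that several exchanges made at once may interfere. The layers of the search put them into a
  triangular order, in each matroid in the opposite direction.\<close>

locale fin_matroid =
  fixes V :: "'a set" and I :: "'a set set"
  assumes matroid: "matroid V I"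
begin

lemma finite_V: "finite V" 
  and indep_subset_V: "S \<in> I \<Longrightarrow> S \<subseteq> V"
  and indep_subset: "S \<in> I \<Longrightarrow> T \<subseteq> S \<Longrightarrow> T \<in> I"
  and indep_exchange: "S \<in> I \<Longrightarrow> T \<in> I \<Longrightarrow> card T < card S \<Longrightarrow> \<exists>x\<in>S - T. insert x T \<in> I"
  using matroid unfolding matroid_def by auto

lemma indep_empty [simp]: "{} \<in> I"
  using matroid unfolding matroid_def by blast

lemma finite_indep: "S \<in> I \<Longrightarrow> finite S"
  using finite_V indep_subset_V finite_subset by blast

lemma finite_I: "finite I"
  using finite_subset[of I "Pow V"] finite_V indep_subset_V by blast

definition rk :: "'a set \<Rightarrow> nat" where
  "rk A = Max (card ` {T \<in> I. T \<subseteq> A})"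

definition cl :: "'a set \<Rightarrow> 'a set" where
  "cl A = {x \<in> V. rk (insert x A) = rk A}"

text \<open>Independence of \<open>X\<close> in the matroid contracted by \<open>A\<close>, stated
  through closure so that \<open>A\<close> may be dependent.\<close>

definition indep_over :: "'a set \<Rightarrow> 'a set \<Rightarrow> bool" where
  "indep_over A X \<longleftrightarrow> (\<forall>x\<in>X. x \<notin> cl (A \<union> (X - {x})))"

lemma card_le_rk: "T \<in> I \<Longrightarrow> T \<subseteq> A \<Longrightarrow> card T \<le> rk A"
  unfolding rk_def using finite_I by (auto intro!: Max_ge)

lemma rk_witness: obtains T where "T \<in> I" "T \<subseteq> A" "card T = rk A"
proof -
  have "rk A \<in> card ` {T \<in> I. T \<subseteq> A}"
    unfolding rk_def using finite_I indep_empty by (intro Max_in) (auto simp del: indep_empty)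
  then show ?thesis using that by auto
qed

lemma rk_mono: "A \<subseteq> B \<Longrightarrow> rk A \<le> rk B"
  using rk_witness[of A] card_le_rk[of _ B] by (metis subset_trans)

lemma extend_indep:
  assumes "T \<in> I" "T \<subseteq> A"
  obtains B where "B \<in> I" "T \<subseteq> B" "B \<subseteq> A" "card B = rk A"
proof -
  let ?F = "{B \<in> I. T \<subseteq> B \<and> B \<subseteq> A}"
  have "finite ?F" "?F \<noteq> {}" using finite_I assms by auto
  then have "Max (card ` ?F) \<in> card ` ?F" by (intro Max_in) auto
  then obtain B where B: "B \<in> ?F" "card B = Max (card ` ?F)" by auto
  have max: "card C \<le> card B" if "C \<in> ?F" for C
    using that \<open>finite ?F\<close> B(2) by simp
  obtain J where J: "J \<in> I" "J \<subseteq> A" "card J = rk A" using rk_witness .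
  have "\<not> card B < card J"
  proof
    assume "card B < card J"
    then obtain x where x: "x \<in> J - B" "insert x B \<in> I"
      using indep_exchange[of J B] J B by auto
    then have "card (insert x B) \<le> card B" using B J by (intro max) auto
    then show False using x finite_indep[of B] B by auto
  qed
  then have "card B = rk A" using J card_le_rk[of B A] B by auto
  then show ?thesis using that B by auto
qed

lemma rk_indep: "T \<in> I \<Longrightarrow> rk T = card T"
  using card_le_rk[of T T] rk_witness[of T] card_mono[OF finite_indep] by (metis le_antisym order_refl)

lemma indep_iff_rk:
  assumes "T \<subseteq> V" shows "T \<in> I \<longleftrightarrow> rk T = card T"
proof -
  obtain J where "J \<in> I" "J \<subseteq> T" "card J = rk T" using rk_witness .
  moreover have "finite T" using assms finite_V finite_subset by blast
  ultimately show ?thesis using rk_indep card_subset_eq[of T J] by auto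
qed

lemma rk_insert_le: "rk (insert x A) \<le> rk A + 1"
proof -
  obtain T where T: "T \<in> I" "T \<subseteq> insert x A" "card T = rk (insert x A)" using rk_witness .
  have "card (T - {x}) \<le> rk A" using T indep_subset[of T "T - {x}"] by (intro card_le_rk) auto
  moreover have "card T \<le> card (T - {x}) + 1" using card_Diff1_le[of T x] card_Suc_Diff1[OF finite_indep[OF T(1)], of x]
    by (cases "x \<in> T") auto
  ultimately show ?thesis using T by simp
qed

lemma cl_subset_V: "cl A \<subseteq> V"
  and cl_extensive: "x \<in> A \<Longrightarrow> x \<in> V \<Longrightarrow> x \<in> cl A"
  unfolding cl_def by (auto simp: insert_absorb)

lemma rk_insert_notin_cl: "x \<in> V \<Longrightarrow> x \<notin> cl A \<Longrightarrow> rk (insert x A) = rk A + 1"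
  using rk_insert_le[of x A] rk_mono[of A "insert x A"] unfolding cl_def by force

lemma rk_insert_in_cl: "x \<in> cl A \<Longrightarrow> rk (insert x A) = rk A"
  unfolding cl_def by simp

text \<open>An independent subset of the union that is larger than a basis of \<open>A\<close> would
  contain an element enlarging that basis, but no element of \<open>A\<close> or \<open>cl A\<close>
  does so.\<close>

lemma rk_Un_cl:
  assumes "B \<subseteq> cl A" shows "rk (A \<union> B) = rk A"
proof (rule ccontr)
  assume "\<not> ?thesis"
  then have lt: "rk A < rk (A \<union> B)" using rk_mono[of A "A \<union> B"] by simp
  obtain T where T: "T \<in> I" "T \<subseteq> A" "card T = rk A" using rk_witness .
  obtain J where J: "J \<in> I" "J \<subseteq> A \<union> B" "card J = rk (A \<union> B)" using rk_witness .
  obtain x where x: "x \<in> J - T" "insert x T \<in> I" using indep_exchange[OF J(1) T(1)] lt J T by auto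
  have "card (insert x T) = rk A + 1" using x T finite_indep by auto
  moreover have "card (insert x T) \<le> rk (insert x A)" using x T by (intro card_le_rk) auto
  moreover have "rk (insert x A) = rk A"
    using x J assms rk_insert_in_cl by (cases "x \<in> A") (auto simp: insert_absorb)
  ultimately show False by simp
qed

text \<open>A basis of \<open>A\<close> extends to one of \<open>B\<close> and then to one of
  \<open>insert x B\<close>. If \<open>x\<close> raised the rank of \<open>B\<close>, the last basis
  would contain \<open>x\<close>, so \<open>x\<close> would enlarge the first basis as well.\<close>

lemma cl_mono:
  assumes "A \<subseteq> B" shows "cl A \<subseteq> cl B"
proof
  fix x assume x: "x \<in> cl A"
  obtain T where T: "T \<in> I" "T \<subseteq> A" "card T = rk A" using rk_witness .
  obtain T' where T': "T' \<in> I" "T \<subseteq> T'" "T' \<subseteq> B" "card T' = rk B"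
    by (rule extend_indep[OF T(1), of B]) (use T(2) assms in auto)
  obtain J where J: "J \<in> I" "T' \<subseteq> J" "J \<subseteq> insert x B" "card J = rk (insert x B)"
    by (rule extend_indep[OF T'(1), of "insert x B"]) (use T'(3) in auto)
  have "x \<in> V" using x cl_subset_V by auto
  show "x \<in> cl B"
  proof (rule ccontr)
    assume nx: "x \<notin> cl B"
    then have "x \<notin> B" using \<open>x \<in> V\<close> cl_extensive by auto
    have "card J = rk B + 1" using J rk_insert_notin_cl[OF \<open>x \<in> V\<close> nx] by simp
    then have "\<not> J \<subseteq> B" using card_le_rk[OF J(1), of B] by auto
    then have "x \<in> J" using J by auto
    then have "insert x T \<in> I" using J T' indep_subset[of J "insert x T"] by auto
    then have "card (insert x T) \<le> rk (insert x A)" using T by (intro card_le_rk) auto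
    moreover have "x \<notin> T" using \<open>x \<notin> B\<close> T assms by auto
    ultimately show False using rk_insert_in_cl[OF x] T finite_indep by auto
  qed
qed

lemma cl_mono': "x \<in> cl A \<Longrightarrow> A \<subseteq> B \<Longrightarrow> x \<in> cl B"
  using cl_mono by blast

lemma cl_trans:
  assumes "B \<subseteq> cl A" shows "cl B \<subseteq> cl A"
proof
  fix x assume x: "x \<in> cl B"
  then have "x \<in> cl (A \<union> B)" by (rule cl_mono') simp
  then have "rk (insert x (A \<union> B)) = rk A" using rk_insert_in_cl rk_Un_cl[OF assms] by simp
  moreover have "rk A \<le> rk (insert x A)" "rk (insert x A) \<le> rk (insert x (A \<union> B))"
    by (intro rk_mono; auto)+
  ultimately show "x \<in> cl A" using x cl_subset_V unfolding cl_def by auto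
qed

lemma cl_subset_cl: "B \<subseteq> cl A \<Longrightarrow> x \<in> cl B \<Longrightarrow> x \<in> cl A"
  using cl_trans by blast

lemma rk_le_of_subset_cl: "B \<subseteq> cl A \<Longrightarrow> rk B \<le> rk A"
  using rk_Un_cl[of B A] rk_mono[of B "A \<union> B"] by simp

lemma rk_le_card: "finite A \<Longrightarrow> rk A \<le> card A"
  using rk_witness[of A] card_mono[of A] by metis

lemma cl_exchange:
  assumes "x \<in> cl (insert y A)" "x \<notin> cl A" "y \<in> V"
  shows "y \<in> cl (insert x A)"
proof -
  have "x \<in> V" using assms(1) cl_subset_V by auto
  have "rk (insert x (insert y A)) \<le> rk A + 1"
    using rk_insert_in_cl[OF assms(1)] rk_insert_le[of y A] by simp
  moreover have "rk (insert x A) = rk A + 1" using rk_insert_notin_cl[OF \<open>x \<in> V\<close> assms(2)] .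
  moreover have "rk (insert x A) \<le> rk (insert y (insert x A))" by (intro rk_mono) auto
  ultimately show ?thesis using assms(3) unfolding cl_def by (auto simp: insert_commute)
qed

lemma insert_indep_iff:
  assumes "S \<in> I" "x \<in> V" "x \<notin> S" shows "insert x S \<in> I \<longleftrightarrow> x \<notin> cl S"
proof -
  have "insert x S \<subseteq> V" using assms indep_subset_V by auto
  then have "insert x S \<in> I \<longleftrightarrow> rk (insert x S) = card S + 1"
    using assms(3) finite_indep[OF assms(1)] indep_iff_rk[of "insert x S"] by auto
  also have "\<dots> \<longleftrightarrow> x \<notin> cl S"
    using rk_indep[OF assms(1)] rk_insert_in_cl[of x S] rk_insert_notin_cl[OF assms(2), of S] by linarith
  finally show ?thesis .
qed

lemma insert_indep: "S \<in> I \<Longrightarrow> x \<in> V \<Longrightarrow> x \<notin> cl S \<Longrightarrow> insert x S \<in> I"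
  using insert_indep_iff[of S x] cl_extensive[of x S] by auto

lemma notin_cl_remove:
  assumes "S \<in> I" "y \<in> S" shows "y \<notin> cl (S - {y})"
proof -
  have "insert y (S - {y}) \<in> I" using assms by (simp add: insert_absorb)
  moreover have "S - {y} \<in> I" using assms indep_subset by blast
  ultimately show ?thesis using insert_indep_iff[of "S - {y}" y] assms indep_subset_V by auto
qed

section \<open>Independence relative to a set\<close>

lemma indep_over_mono:
  assumes "indep_over A X" "A' \<subseteq> A" "X' \<subseteq> X" shows "indep_over A' X'"
  unfolding indep_over_def
proof
  fix x assume x: "x \<in> X'"
  have "x \<notin> cl (A \<union> (X - {x}))" using assms x unfolding indep_over_def by auto
  moreover have "cl (A' \<union> (X' - {x})) \<subseteq> cl (A \<union> (X - {x}))" using assms by (intro cl_mono) auto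
  ultimately show "x \<notin> cl (A' \<union> (X' - {x}))" by auto
qed

text \<open>If adding \<open>e\<close> made some \<open>x\<close> in \<open>X\<close> spanned by the
  others, closure exchange would turn this round and span \<open>e\<close> by
  \<open>A \<union> X\<close>.\<close>

lemma indep_over_insert:
  assumes "indep_over A X" "e \<notin> cl (A \<union> X)" "X \<subseteq> V" "e \<in> V"
  shows "indep_over A (insert e X)"
  unfolding indep_over_def
proof
  fix x assume x: "x \<in> insert e X"
  have "e \<notin> X" using assms cl_extensive by auto
  show "x \<notin> cl (A \<union> (insert e X - {x}))"
  proof (cases "x = e")
    case True
    then have "A \<union> (insert e X - {x}) = A \<union> X" using \<open>e \<notin> X\<close> by auto
    then show ?thesis using True assms by simp
  next
    case False
    let ?B = "A \<union> (X - {x})"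
    have eq: "A \<union> (insert e X - {x}) = insert e ?B" "insert x ?B = A \<union> X"
      using False x by auto
    have "x \<notin> cl ?B" using assms False x unfolding indep_over_def by auto
    then show ?thesis using cl_exchange[of x e ?B] assms eq by auto
  qed
qed

lemma rk_indep_over:
  assumes "finite X" "X \<subseteq> V" "indep_over A X" shows "rk (A \<union> X) = rk A + card X"
  using assms
proof (induction X)
  case (insert x X)
  have "indep_over A X" using insert.prems(2) by (rule indep_over_mono) auto
  moreover have "x \<notin> cl (A \<union> X)"
    using insert.prems(2) insert.hyps unfolding indep_over_def by auto
  ultimately show ?case using insert rk_insert_notin_cl[of x "A \<union> X"] by simp
qed simp

lemma indep_over_indep_Un:
  assumes "J \<in> I" "J \<subseteq> A" "indep_over A X" "X \<subseteq> V" shows "J \<union> X \<in> I"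
proof -
  have "finite X" using assms finite_V finite_subset by blast
  moreover have "indep_over J X" using assms indep_over_mono by blast
  ultimately have "rk (J \<union> X) = card J + card X"
    using assms rk_indep_over rk_indep by simp
  moreover have "card (J \<union> X) \<le> card J + card X" by (rule card_Un_le)
  moreover have "rk (J \<union> X) \<le> card (J \<union> X)"
    using \<open>finite X\<close> assms finite_indep by (intro rk_le_card) auto
  ultimately show ?thesis using assms indep_subset_V by (subst indep_iff_rk) auto
qed

section \<open>Fundamental circuits and sequences of exchanges\<close>

definition circ :: "'a set \<Rightarrow> 'a \<Rightarrow> 'a set" where
  "circ S x = {y \<in> S. x \<notin> cl (S - {y})}"

text \<open>Here \<open>circ S x\<close> is the fundamental circuit of \<open>x\<close> without
  \<open>x\<close> itself. Elements outside it can be deleted one by one: if deleting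
  \<open>y\<close> lost \<open>x\<close>, then \<open>y\<close> would be spanned by \<open>x\<close>
  and the remaining elements, all of which lie in \<open>cl (S - {y})\<close>. The equivalence lets
  a single query decide whether a set meets the circuit.\<close>

lemma in_cl_iff_circ_subset:
  assumes "S \<in> I" "x \<in> cl S" "D \<subseteq> S"
  shows "x \<in> cl D \<longleftrightarrow> circ S x \<subseteq> D"
proof
  assume "x \<in> cl D"
  show "circ S x \<subseteq> D"
  proof
    fix y assume "y \<in> circ S x"
    then have "\<not> D \<subseteq> S - {y}" using cl_mono'[OF \<open>x \<in> cl D\<close>] unfolding circ_def by auto
    then show "y \<in> D" using assms(3) by auto
  qed
next
  assume D: "circ S x \<subseteq> D"
  have "x \<in> cl (S - E)" if "finite E" "E \<subseteq> S - circ S x" for E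
    using that
  proof (induction E)
    case empty then show ?case using assms by simp
  next
    case (insert y E)
    have IH: "x \<in> cl (S - E)" using insert by auto
    have y: "y \<in> S" "x \<in> cl (S - {y})" using insert.prems unfolding circ_def by auto
    show ?case
    proof (rule ccontr)
      assume n: "x \<notin> cl (S - insert y E)"
      have "insert y (S - insert y E) = S - E" using y insert by auto
      then have "y \<in> cl (insert x (S - insert y E))"
        using cl_exchange[of x y "S - insert y E"] IH n y(1) indep_subset_V[OF assms(1)] by auto
      moreover have "insert x (S - insert y E) \<subseteq> cl (S - {y})"
        using y(2) cl_extensive[of _ "S - {y}"] indep_subset_V[OF assms(1)] by blast
      ultimately have "y \<in> cl (S - {y})" by (rule cl_subset_cl[rotated])
      then show False using notin_cl_remove[OF assms(1) y(1)] by simp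
    qed
  qed
  from this[of "S - D"] have "x \<in> cl (S - (S - D))"
    using D finite_indep[OF assms(1)] by blast
  then show "x \<in> cl D" using assms(3) by (simp add: double_diff)
qed

lemma circ_subset: "circ S x \<subseteq> S"
  unfolding circ_def by auto

lemma in_circ_iff:
  assumes "S \<in> I" "y \<in> S" "x \<in> V - S"
  shows "y \<in> circ S x \<longleftrightarrow> insert x (S - {y}) \<in> I"
  using assms insert_indep_iff[of "S - {y}" x] indep_subset[of S "S - {y}"]
  unfolding circ_def by auto

text \<open>The order is triangular: the circuit of \<open>x i\<close> contains \<open>y i\<close>
  but none of the earlier \<open>y\<close>. Each swap therefore takes place in the untouched part of
  \<open>S\<close>. Staying inside \<open>cl S\<close> leaves room for one more element from
  outside.\<close>

lemma swaps_indep: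
  fixes n :: nat and x y :: "nat \<Rightarrow> 'a"
  assumes S: "S \<in> I"
    and y: "\<And>i. i < n \<Longrightarrow> y i \<in> S" "inj_on y {..<n}"
    and x: "\<And>i. i < n \<Longrightarrow> x i \<notin> S" "inj_on x {..<n}"
    and in_cl: "\<And>i. i < n \<Longrightarrow> x i \<in> cl (S - y ` {..<i})"
    and notin_cl: "\<And>i. i < n \<Longrightarrow> x i \<notin> cl (S - {y i})"
  shows "(S - y ` {..<n}) \<union> x ` {..<n} \<in> I \<and> (S - y ` {..<n}) \<union> x ` {..<n} \<subseteq> cl S"
proof -
  have V: "S \<subseteq> V" using S indep_subset_V by auto
  have *: "(S - y ` {..<m}) \<union> x ` {..<m} \<in> I \<and> (S - y ` {..<m}) \<union> x ` {..<m} \<subseteq> cl S"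
    if "m \<le> n" for m
    using that
  proof (induction m)
    case 0
    have "S \<subseteq> cl S" using V cl_extensive by blast
    then show ?case using S by simp
  next
    case (Suc m)
    define R where "R = S - y ` {..<m}"
    define S' where "S' = R \<union> x ` {..<m}"
    have IH: "S' \<in> I" "S' \<subseteq> cl S" using Suc unfolding S'_def R_def by auto
    have m: "m < n" using Suc by auto
    have "y m \<noteq> y i" "x m \<noteq> x i" if "i < m" for i
      using inj_onD[OF y(2), of m i] inj_onD[OF x(2), of m i] that m by auto
    then have ym: "y m \<in> R" and xm: "x m \<notin> S'"
      using y(1)[OF m] x(1)[OF m] unfolding S'_def R_def by auto
    have "x i \<noteq> y m" if "i < m" for i
      using x(1)[of i] y(1)[OF m] m that by auto
    then have xm2: "y m \<notin> x ` {..<m}" by force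
    have eq: "(S - y ` {..<Suc m}) \<union> x ` {..<Suc m} = insert (x m) (S' - {y m})"
      using xm2 unfolding S'_def R_def by (auto simp: lessThan_Suc)
    have xR: "x m \<in> cl R" "x m \<notin> cl (R - {y m})"
      using in_cl[OF m] notin_cl[OF m] cl_mono[of "R - {y m}" "S - {y m}"] unfolding R_def by auto
    have xV: "x m \<in> V" using xR cl_subset_V by auto
    \<comment> \<open>\<open>R\<close> is what the earlier swaps left of \<open>S\<close>. It spans
      \<open>x m\<close> only with the help of \<open>y m\<close>, so \<open>x m\<close> and
      \<open>R - {y m}\<close> span \<open>y m\<close>. If \<open>S' - {y m}\<close> spanned
      \<open>x m\<close>, it would span \<open>y m\<close> too, against the independence of
      \<open>S'\<close>.\<close>
    have "x m \<notin> cl (S' - {y m})"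
    proof
      assume a: "x m \<in> cl (S' - {y m})"
      have "y m \<in> cl (insert (x m) (R - {y m}))"
        using cl_exchange[of "x m" "y m" "R - {y m}"] xR ym V
        by (auto simp: insert_absorb R_def)
      moreover have "R - {y m} \<subseteq> S' - {y m}" "R \<subseteq> V"
        using V unfolding S'_def R_def by auto
      then have "insert (x m) (R - {y m}) \<subseteq> cl (S' - {y m})"
        using a cl_extensive[of _ "S' - {y m}"] by blast
      ultimately have "y m \<in> cl (S' - {y m})" by (rule cl_subset_cl[rotated])
      moreover have "y m \<in> S'" using ym unfolding S'_def by simp
      ultimately show False using notin_cl_remove[OF IH(1)] by simp
    qed
    then have "insert (x m) (S' - {y m}) \<in> I"
      using insert_indep_iff[of "S' - {y m}" "x m"] indep_subset[OF IH(1)] xm xV by auto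
    moreover have "x m \<in> cl S" by (rule cl_mono'[OF xR(1)]) (auto simp: R_def)
    then have "insert (x m) (S' - {y m}) \<subseteq> cl S" using IH(2) by auto
    ultimately show ?case unfolding eq by simp
  qed
  then show ?thesis by simp
qed

end

section \<open>Query programs with a cost counter\<close>

text \<open>Query trees with results of any type, so that subroutines can be sequenced. The flag
  names the oracle, \<open>True\<close> for the first one.\<close>

datatype ('a, 'b) prog =
    Return 'b
  | Ask bool "'a set" "bool \<Rightarrow> ('a, 'b) prog"

primrec bind :: "('a, 'b) prog \<Rightarrow> ('b \<Rightarrow> ('a, 'c) prog) \<Rightarrow> ('a, 'c) prog" where
  "bind (Return x) f = f x"
| "bind (Ask i S k) f = Ask i S (\<lambda>b. bind (k b) f)"

text \<open>Weakest preconditions for the actual run; \<open>c\<close> counts the queries made so far.\<close>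

primrec wp :: "'a set \<Rightarrow> (bool \<Rightarrow> 'a set \<Rightarrow> bool) \<Rightarrow> ('a, 'b) prog \<Rightarrow> nat \<Rightarrow> ('b \<Rightarrow> nat \<Rightarrow> bool) \<Rightarrow> bool" where
  "wp V orc (Return x) = (\<lambda>c Q. Q x c)"
| "wp V orc (Ask i S k) = (\<lambda>c Q. S \<subseteq> V \<and> wp V orc (k (orc i S)) (c + 1) Q)"

lemma wp_bind: "wp V orc (bind p f) c Q = wp V orc p c (\<lambda>x c'. wp V orc (f x) c' Q)"
  by (induction p arbitrary: c) auto

text \<open>Branches that leave \<open>V\<close> are never reached in an actual run, but \<^const>\<open>queries_within\<close>
  inspects them too; they are cut off.\<close>

primrec to_tree :: "'a set \<Rightarrow> ('a, 'a set) prog \<Rightarrow> 'a query_tree" where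
  "to_tree V (Return S) = Output S"
| "to_tree V (Ask i S k) =
     (if S \<subseteq> V then (if i then Query1 else Query2) S (\<lambda>b. to_tree V (k b)) else Output {})"

lemma queries_within_to_tree: "queries_within V (to_tree V p)"
  by (induction p) auto

lemma wp_to_tree:
  assumes "wp V (\<lambda>i S. S \<in> (if i then I\<^sub>1 else I\<^sub>2)) p c Q"
  shows "Q (run I\<^sub>1 I\<^sub>2 (to_tree V p)) (c + num_queries I\<^sub>1 I\<^sub>2 (to_tree V p))"
  using assms
proof (induction p arbitrary: c)
  case (Ask i S k)
  then show ?case using Ask.IH[OF rangeI, of "S \<in> (if i then I\<^sub>1 else I\<^sub>2)" "c + 1"] by auto
qed simp

text \<open>Simulates the oracles of the truncated matroids: the original query is asked and its
  answer overruled on large sets, so a simulated query costs one query.\<close>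

primrec trunc :: "nat \<Rightarrow> ('a, 'b) prog \<Rightarrow> ('a, 'b) prog" where
  "trunc m (Return x) = Return x"
| "trunc m (Ask i S k) = Ask i S (\<lambda>b. trunc m (k (b \<and> card S \<le> m)))"

lemma wp_trunc: "wp V orc (trunc m p) c Q = wp V (\<lambda>i S. orc i S \<and> card S \<le> m) p c Q"
  by (induction p arbitrary: c) auto

subsection \<open>Greedy scans\<close>

text \<open>A scan that concerns one matroid only passes the empty set to the other oracle, where
  the answer is positive. One cost analysis then serves all scans at the price of a constant
  factor.\<close>

primrec scan :: "('a set \<Rightarrow> 'a \<Rightarrow> 'a set) \<Rightarrow> ('a set \<Rightarrow> 'a \<Rightarrow> 'a set) \<Rightarrow> 'a list \<Rightarrow> 'a set \<Rightarrow> ('a, 'a set) prog" where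
  "scan f g [] A = Return A"
| "scan f g (x # xs) A = Ask True (f A x) (\<lambda>b. Ask False (g A x) (\<lambda>b'.
     scan f g xs (if b \<and> b' then insert x A else A)))"

primrec select :: "('a set \<Rightarrow> 'a \<Rightarrow> bool) \<Rightarrow> 'a list \<Rightarrow> 'a set \<Rightarrow> 'a set" where
  "select P [] A = A"
| "select P (x # xs) A = select P xs (if P A x then insert x A else A)"

lemma wp_scan:
  assumes "\<And>A x. A \<subseteq> V \<Longrightarrow> x \<in> set xs \<Longrightarrow> f A x \<subseteq> V \<and> g A x \<subseteq> V" "A \<subseteq> V" "set xs \<subseteq> V"
    "Q (select (\<lambda>A x. orc True (f A x) \<and> orc False (g A x)) xs A) (c + 2 * length xs)"
  shows "wp V orc (scan f g xs A) c Q"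
  using assms
proof (induction xs arbitrary: A c)
  case (Cons x xs)
  let ?A = "if orc True (f A x) \<and> orc False (g A x) then insert x A else A"
  have "wp V orc (scan f g xs ?A) (c + 2) Q"
    using Cons.prems by (intro Cons.IH) (auto simp: algebra_simps)
  moreover have "f A x \<subseteq> V \<and> g A x \<subseteq> V" using Cons.prems by auto
  ultimately show ?case by auto
qed simp

lemma wp_scan_bind:
  assumes "\<And>A x. A \<subseteq> V \<Longrightarrow> x \<in> set xs \<Longrightarrow> f A x \<subseteq> V" "\<And>A x. A \<subseteq> V \<Longrightarrow> x \<in> set xs \<Longrightarrow> g A x \<subseteq> V"
    and "A \<subseteq> V" "set xs \<subseteq> V" "length xs \<le> l"
    and "select (\<lambda>A x. orc True (f A x) \<and> orc False (g A x)) xs A = R"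
    and "\<And>c'. c' \<le> c + 2 * l \<Longrightarrow> wp V orc (h R) c' Q"
  shows "wp V orc (bind (scan f g xs A) h) c Q"
  unfolding wp_bind using assms by (intro wp_scan) auto

lemma select_subset: "A \<subseteq> select P xs A" "select P xs A \<subseteq> A \<union> set xs"
  by (induction xs arbitrary: A) (auto split: if_splits; fastforce)+

lemma select_invariant:
  assumes "J A" "\<And>A x. J A \<Longrightarrow> x \<in> set xs \<Longrightarrow> P A x \<Longrightarrow> J (insert x A)"
  shows "J (select P xs A)"
  using assms by (induction xs arbitrary: A) auto

text \<open>Recovers the state \<open>B\<close> at the moment of the rejection. It is part of the
  final result, so a dependence found then persists, and it holds only initial and earlier elements,
  which matters for sorted lists.\<close>

lemma select_rejected:
  assumes "x \<in> set xs" "x \<notin> select P xs A"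
  obtains B ys zs where "xs = ys @ x # zs" "B \<subseteq> select P xs A" "A \<subseteq> B" "B \<subseteq> A \<union> set ys" "\<not> P B x"
  using assms
proof (induction xs arbitrary: A thesis)
  case (Cons z xs)
  let ?A = "if P A z then insert z A else A"
  show ?case
  proof (cases "x = z \<and> \<not> P A x")
    case True
    then show ?thesis using Cons.prems(1)[of "[]" xs A] select_subset(1)[of A P xs] by auto
  next
    case False
    then have "x \<in> set xs" using Cons.prems(2,3) select_subset(1)[of ?A P xs] by auto
    then obtain B ys zs where "xs = ys @ x # zs" "B \<subseteq> select P xs ?A" "?A \<subseteq> B" "B \<subseteq> ?A \<union> set ys" "\<not> P B x"
      using Cons.IH[of ?A] Cons.prems(3) by auto
    then show ?thesis using Cons.prems(1)[of "z # ys" zs B] by (auto split: if_splits)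
  qed
qed simp

lemma select_filter: "select (\<lambda>A x. P x) xs A = A \<union> {x \<in> set xs. P x}"
  by (induction xs arbitrary: A) auto

text \<open>The order depends on \<open>w\<close> and \<open>A\<close> alone, never on the matroids,
  so the algorithm stays deterministic and sorting needs no query.\<close>

definition list_by :: "('a \<Rightarrow> nat) \<Rightarrow> 'a set \<Rightarrow> 'a list" where
  "list_by w A = sort_key w (SOME xs. set xs = A \<and> distinct xs)"

lemma list_by:
  assumes "finite A"
  shows "set (list_by w A) = A" "distinct (list_by w A)" "length (list_by w A) = card A"
    "sorted_wrt (\<lambda>x y. w x \<le> w y) (list_by w A)"
proof -
  have *: "set (SOME xs. set xs = A \<and> distinct xs) = A \<and> distinct (SOME xs. set xs = A \<and> distinct xs)"
    using finite_distinct_list[OF assms] by (rule someI_ex)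
  show set: "set (list_by w A) = A" and dist: "distinct (list_by w A)"
    using * by (simp_all add: list_by_def)
  show "length (list_by w A) = card A" using distinct_card[OF dist] set by simp
  show "sorted_wrt (\<lambda>x y. w x \<le> w y) (list_by w A)"
    using sorted_sort_key[of w] by (simp add: list_by_def sorted_map)
qed

context fin_matroid
begin

text \<open>Optimality of the greedy basis for all thresholds at once: a rejected \<open>x\<close>
  is spanned by elements chosen before it, none of larger weight.\<close>

lemma greedy:
  fixes w :: "'a \<Rightarrow> nat"
  assumes "finite A" "A \<subseteq> V"
  defines "R \<equiv> select (\<lambda>B x. insert x B \<in> I) (list_by w A) {}"
  shows "R \<in> I" "R \<subseteq> A" "\<And>q. {x \<in> A. w x \<le> q} \<subseteq> cl {x \<in> R. w x \<le> q}"
proof -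
  note l = list_by[OF assms(1), of w]
  show "R \<in> I" unfolding R_def by (rule select_invariant) auto
  show RA: "R \<subseteq> A" unfolding R_def using select_subset(2)[of _ "list_by w A" "{}"] l by auto
  fix q
  show "{x \<in> A. w x \<le> q} \<subseteq> cl {x \<in> R. w x \<le> q}"
  proof
    fix x assume x: "x \<in> {x \<in> A. w x \<le> q}"
    show "x \<in> cl {x \<in> R. w x \<le> q}"
    proof (cases "x \<in> R")
      case True
      then show ?thesis using x assms(2) by (intro cl_extensive) auto
    next
      case False
      then have "x \<in> set (list_by w A)" "x \<notin> select (\<lambda>B x. insert x B \<in> I) (list_by w A) {}"
        using x l(1) unfolding R_def by auto
      then obtain B ys zs where B: "list_by w A = ys @ x # zs" "B \<subseteq> R" "B \<subseteq> {} \<union> set ys" "insert x B \<notin> I"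
        unfolding R_def by (rule select_rejected)
      have "B \<in> I" using B \<open>R \<in> I\<close> indep_subset by blast
      then have "x \<in> cl B" using insert_indep_iff[of B x] B x assms(2) False by blast
      moreover have "w y \<le> w x" if "y \<in> B" for y
        using l(4) that B unfolding B(1) sorted_wrt_append by auto
      then have "B \<subseteq> {x \<in> R. w x \<le> q}" using B(2) x by force
      ultimately show ?thesis by (rule cl_mono')
    qed
  qed
qed

end

locale two_matroids = M1: fin_matroid V I\<^sub>1 + M2: fin_matroid V I\<^sub>2
  for V :: "'a set" and I\<^sub>1 I\<^sub>2
begin

definition query :: "bool \<Rightarrow> 'a set \<Rightarrow> bool" where
  "query i S \<longleftrightarrow> S \<in> (if i then I\<^sub>1 else I\<^sub>2)"

lemma query_simps [simp]: "query True S \<longleftrightarrow> S \<in> I\<^sub>1" "query False S \<longleftrightarrow> S \<in> I\<^sub>2"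
  by (simp_all add: query_def)

text \<open>The easy half of the matroid intersection min-max theorem. All upper bounds on common
  independent sets below come from a suitable choice of \<open>A\<close> and
  \<open>B\<close>.\<close>

lemma common_le_rk:
  assumes "J \<in> I\<^sub>1" "J \<in> I\<^sub>2" "J \<subseteq> A \<union> B"
  shows "card J \<le> M1.rk A + M2.rk B"
proof -
  have "card J \<le> card (J \<inter> A) + card (J \<inter> B)"
    using assms(3) card_Un_le[of "J \<inter> A" "J \<inter> B"] by (metis Int_Un_distrib Int_absorb2)
  also have "\<dots> \<le> M1.rk A + M2.rk B"
    using assms M1.indep_subset[of J "J \<inter> A"] M2.indep_subset[of J "J \<inter> B"]
    by (intro add_mono M1.card_le_rk M2.card_le_rk) auto
  finally show ?thesis .
qed

end

section \<open>The auction\<close>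

lemma sum_levels:
  fixes w :: "'a \<Rightarrow> nat"
  assumes "finite A" "\<And>e. e \<in> A \<Longrightarrow> w e < k" shows "(\<Sum>q<k. card {e \<in> A. w e = q}) = card A"
proof -
  have "card (\<Union>q\<in>{..<k}. {e \<in> A. w e = q}) = (\<Sum>q<k. card {e \<in> A. w e = q})"
    using assms(1) by (intro card_UN_disjoint) auto
  moreover have "(\<Union>q\<in>{..<k}. {e \<in> A. w e = q}) = A" using assms(2) by auto
  ultimately show ?thesis by simp
qed

text \<open>An element of the current solution \<open>S\<close> was inserted at one below its present price.\<close>

definition bid :: "'a set \<Rightarrow> ('a \<Rightarrow> nat) \<Rightarrow> 'a \<Rightarrow> nat" where
  "bid S p e = (if e \<in> S then p e - 1 else p e)"

text \<open>An offer for \<open>e\<close> is worth \<open>p e + 1\<close>, so solution elements of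
  price at most \<open>p e\<close> do not stand in its way. Accepted offers at other levels are
  ignored as well; conflicts between levels are settled when the solution is recomputed.\<close>

definition above :: "'a set \<Rightarrow> ('a \<Rightarrow> nat) \<Rightarrow> 'a set \<Rightarrow> 'a \<Rightarrow> 'a set" where
  "above S p W e = {s \<in> S. p e < p s} \<union> {w \<in> W. p w = p e}"

text \<open>The independent set \<open>T\<close> spans the elements of bid below each threshold and
  stands in for them, since a query about a dependent set would say nothing about
  \<open>e\<close>.\<close>

definition below :: "'a set \<Rightarrow> ('a \<Rightarrow> nat) \<Rightarrow> 'a set \<Rightarrow> 'a set \<Rightarrow> 'a \<Rightarrow> 'a set" where
  "below S p T W e = {t \<in> T. bid S p t < p e} \<union> {s \<in> S. bid S p s = p e} \<union> {w \<in> W. p w = p e}"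

text \<open>\<open>N\<close> bounds the number of rounds. \<open>N'\<close> holds the candidates
  that the second matroid would still admit once \<open>W\<close> is final. Winners and candidates
  outside \<open>N'\<close> rise in price; a candidate that only the first matroid refuses keeps its
  price.\<close>

primrec auction :: "'a set \<Rightarrow> nat \<Rightarrow> nat \<Rightarrow> nat \<Rightarrow> 'a set \<Rightarrow> ('a \<Rightarrow> nat) \<Rightarrow> ('a, 'a set) prog" where
  "auction V k d 0 S p = Return S"
| "auction V k d (Suc N) S p =
     bind (scan (\<lambda>B e. insert e B) (\<lambda>_ _. {}) (list_by (bid S p) {e \<in> V. bid S p e < k}) {}) (\<lambda>T.
     if card T \<le> card S + d then Return S else
       let xs = list_by (\<lambda>_. 0) {e \<in> V - S. p e < k} in
       bind (scan (\<lambda>W e. insert e (below S p T W e)) (\<lambda>W e. insert e (above S p W e)) xs {}) (\<lambda>W.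
       bind (scan (\<lambda>_ _. {}) (\<lambda>_ e. insert e (above S p W e)) xs {}) (\<lambda>N'.
       let p' = (\<lambda>e. if e \<in> W \<or> (e \<in> V - S \<and> p e < k \<and> e \<notin> N') then p e + 1 else p e) in
       bind (scan (\<lambda>_ _. {}) (\<lambda>B e. insert e B) (list_by (\<lambda>e. k - p' e) (S \<union> W)) {}) (\<lambda>S'.
       auction V k d N S' p'))))"

context two_matroids
begin

text \<open>The two basis conditions are stated as spanning and independence at every threshold, the
  form in which the duality bound and the rank counts use them.\<close>

definition auction_inv :: "nat \<Rightarrow> 'a set \<Rightarrow> ('a \<Rightarrow> nat) \<Rightarrow> bool" where
  "auction_inv k S p \<longleftrightarrow> S \<subseteq> V \<and> S \<in> I\<^sub>2 \<and> (\<forall>e\<in>S. 1 \<le> p e) \<and> (\<forall>e\<in>V. p e \<le> k) \<and>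
     (\<forall>q\<ge>1. {e \<in> V. q \<le> p e} \<subseteq> M2.cl {e \<in> S. q \<le> p e}) \<and>
     (\<forall>q. M1.indep_over {e \<in> V. bid S p e < q} {e \<in> S. bid S p e = q})"

text \<open>Each sum is at most \<open>k * m\<close> if \<open>m\<close> bounds all ranks, and
  neither grows when prices and bids rise.\<close>

definition potential :: "nat \<Rightarrow> nat \<Rightarrow> 'a set \<Rightarrow> ('a \<Rightarrow> nat) \<Rightarrow> nat" where
  "potential m k S p = (\<Sum>q<k. m - M2.rk {e \<in> V. q < p e}) + (\<Sum>q<k. M1.rk {e \<in> V. bid S p e \<le> q})"

end

section \<open>Consequences of the auction invariant\<close>

locale auction_state = two_matroids V I\<^sub>1 I\<^sub>2 for V :: "'a set" and I\<^sub>1 I\<^sub>2 +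
  fixes k :: nat and S :: "'a set" and p :: "'a \<Rightarrow> nat"
  assumes inv: "auction_inv k S p"
begin

abbreviation b :: "'a \<Rightarrow> nat" where "b \<equiv> bid S p"

lemma S_subset: "S \<subseteq> V"
  and S_indep2: "S \<in> I\<^sub>2"
  and price_pos: "e \<in> S \<Longrightarrow> 1 \<le> p e"
  and price_le: "e \<in> V \<Longrightarrow> p e \<le> k"
  and price_span: "1 \<le> q \<Longrightarrow> {e \<in> V. q \<le> p e} \<subseteq> M2.cl {e \<in> S. q \<le> p e}"
  and bid_indep: "M1.indep_over {e \<in> V. b e < q} {e \<in> S. b e = q}"
  using inv unfolding auction_inv_def by auto

lemma finite_S: "finite S"
  using S_subset M1.finite_V finite_subset by blast

lemma bid_le: "b e \<le> p e"
  by (simp add: bid_def)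

lemma bid_less: "e \<in> S \<Longrightarrow> b e < k"
  using price_pos[of e] price_le[of e] S_subset by (auto simp: bid_def)

lemma price_bid: "e \<in> S \<Longrightarrow> p e = b e + 1"
  using price_pos[of e] by (simp add: bid_def)

lemma S_indep1: "S \<in> I\<^sub>1"
proof -
  have "{e \<in> S. b e < q} \<in> I\<^sub>1" for q
  proof (induction q)
    case (Suc q)
    have "{e \<in> S. b e < Suc q} = {e \<in> S. b e < q} \<union> {e \<in> S. b e = q}" by auto
    moreover have "{e \<in> S. b e < q} \<union> {e \<in> S. b e = q} \<in> I\<^sub>1"
      using Suc S_subset by (intro M1.indep_over_indep_Un[OF _ _ bid_indep[of q]]) auto
    ultimately show ?case by simp
  qed simp
  from this[of k] show ?thesis using bid_less by (metis (no_types, lifting) Collect_cong Collect_mem_eq)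
qed

lemma rk1_step: "M1.rk {e \<in> V. b e < q} + card {e \<in> S. b e = q} \<le> M1.rk {e \<in> V. b e < Suc q}"
proof -
  have "M1.rk {e \<in> V. b e < q} + card {e \<in> S. b e = q} = M1.rk ({e \<in> V. b e < q} \<union> {e \<in> S. b e = q})"
    using finite_S S_subset by (intro M1.rk_indep_over[OF _ _ bid_indep, symmetric]) auto
  also have "\<dots> \<le> M1.rk {e \<in> V. b e < Suc q}" using S_subset by (intro M1.rk_mono) auto
  finally show ?thesis .
qed

lemma rk1_steps:
  assumes "q \<le> j"
  shows "M1.rk {e \<in> V. b e < q} + card {e \<in> S. q \<le> b e \<and> b e < j} \<le> M1.rk {e \<in> V. b e < j}"
  using assms
proof (induction j rule: dec_induct)
  case (step j)
  have "{e \<in> S. q \<le> b e \<and> b e < Suc j} = {e \<in> S. q \<le> b e \<and> b e < j} \<union> {e \<in> S. b e = j}"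
    using step by auto
  then have "card {e \<in> S. q \<le> b e \<and> b e < Suc j} \<le> card {e \<in> S. q \<le> b e \<and> b e < j} + card {e \<in> S. b e = j}"
    by (simp add: card_Un_le)
  then show ?case using step rk1_step[of j] by linarith
next
  case base
  have "card {e \<in> S. q \<le> b e \<and> b e < q} = 0" by (rule card_eq_0_iff[THEN iffD2]) auto
  then show ?case by linarith
qed

text \<open>Weak duality for the cut \<open>{b < q}\<close>, \<open>{p \<ge> q}\<close>, averaged over the thresholds \<open>q\<close>.\<close>

lemma common_indep_bound:
  assumes J: "J \<in> I\<^sub>1" "J \<in> I\<^sub>2"
  shows "k * card J \<le> k * M1.rk {e \<in> V. b e < k} + card S"
proof -
  have *: "card J \<le> M1.rk {e \<in> V. b e < k} + card {e \<in> S. b e = q}" if "q < k" for q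
  proof -
    have "b e < Suc q \<or> Suc q \<le> p e" for e using bid_le[of e] by linarith
    then have "J \<subseteq> {e \<in> V. b e < Suc q} \<union> {e \<in> V. Suc q \<le> p e}"
      using M1.indep_subset_V[OF J(1)] by auto
    then have "card J \<le> M1.rk {e \<in> V. b e < Suc q} + M2.rk {e \<in> V. Suc q \<le> p e}"
      by (rule common_le_rk[OF J])
    also have "M2.rk {e \<in> V. Suc q \<le> p e} \<le> M2.rk {e \<in> S. Suc q \<le> p e}"
      by (intro M2.rk_le_of_subset_cl price_span) simp
    also have "M2.rk {e \<in> S. Suc q \<le> p e} \<le> card {e \<in> S. Suc q \<le> p e}"
      using finite_S by (intro M2.rk_le_card) auto
    \<comment> \<open>The price of an element of \<open>S\<close> is its bid plus one, so the
      elements of bid \<open>q\<close> count on both sides of the cut. This is the loss at threshold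
      \<open>q\<close>; over all thresholds it adds up to \<open>card S\<close>.\<close>
    also have "{e \<in> S. Suc q \<le> p e} = {e \<in> S. Suc q \<le> b e \<and> b e < k} \<union> {e \<in> S. b e = q}"
    proof -
      have "Suc q \<le> p e \<longleftrightarrow> (Suc q \<le> b e \<and> b e < k) \<or> b e = q" if "e \<in> S" for e
        using price_bid[OF that] bid_less[OF that] by linarith
      then show ?thesis by auto
    qed
    also have "card \<dots> \<le> card {e \<in> S. Suc q \<le> b e \<and> b e < k} + card {e \<in> S. b e = q}"
      by (rule card_Un_le)
    also have "M1.rk {e \<in> V. b e < Suc q} + (card {e \<in> S. Suc q \<le> b e \<and> b e < k} + card {e \<in> S. b e = q})
        \<le> M1.rk {e \<in> V. b e < k} + card {e \<in> S. b e = q}"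
      using rk1_steps[of "Suc q" k] that by simp
    finally show ?thesis by simp
  qed
  have "(\<Sum>q<k. card J) \<le> (\<Sum>q<k. M1.rk {e \<in> V. b e < k} + card {e \<in> S. b e = q})"
    by (rule sum_mono) (simp add: *)
  also have "\<dots> = (\<Sum>q<k. M1.rk {e \<in> V. b e < k}) + (\<Sum>q<k. card {e \<in> S. b e = q})"
    by (rule sum.distrib)
  also have "(\<Sum>q<k. card {e \<in> S. b e = q}) = card S"
    by (rule sum_levels[OF finite_S]) (rule bid_less)
  finally show ?thesis by simp
qed

end

section \<open>One round of the auction\<close>

locale auction_round = auction_state V I\<^sub>1 I\<^sub>2 k S p for V :: "'a set" and I\<^sub>1 I\<^sub>2 k S p +
  fixes T W :: "'a set"
  assumes T_indep: "T \<in> I\<^sub>1"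
    and T_subset: "T \<subseteq> {e \<in> V. b e < k}"
    and T_span: "q \<le> k \<Longrightarrow> {e \<in> V. b e < q} \<subseteq> M1.cl {t \<in> T. b t < q}"
    and W_def: "W = select (\<lambda>W e. insert e (below S p T W e) \<in> I\<^sub>1 \<and> insert e (above S p W e) \<in> I\<^sub>2)
        (list_by (\<lambda>_. 0) {e \<in> V - S. p e < k}) {}"
begin

lemma set_candidates: "set (list_by (\<lambda>_. 0) {e \<in> V - S. p e < k}) = {e \<in> V - S. p e < k}"
  using M1.finite_V by (intro list_by) auto

lemma W_subset: "W \<subseteq> {e \<in> V - S. p e < k}"
  using select_subset(2)[of _ "list_by (\<lambda>_. 0) {e \<in> V - S. p e < k}" "{}"] set_candidates
  unfolding W_def by auto

lemma card_T: "card T = M1.rk {e \<in> V. b e < k}"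
proof -
  have "{t \<in> T. b t < k} = T" using T_subset by auto
  then have "M1.rk {e \<in> V. b e < k} \<le> M1.rk T" using T_span[of k] M1.rk_le_of_subset_cl by simp
  then show ?thesis using M1.rk_indep[OF T_indep] M1.rk_mono[OF T_subset] by simp
qed

text \<open>Accepting \<open>x\<close> affects the level \<open>p x\<close> only. As
  \<open>T\<close> spans all lower bids, independence from \<open>below\<close>, which is one query,
  already gives independence over all elements of lower bid together with the level itself.\<close>

lemma W_indep1: "M1.indep_over {e \<in> V. b e < q} ({e \<in> S. b e = q} \<union> {w \<in> W. p w = q})"
  and W_indep2: "{s \<in> S. q < p s} \<union> {w \<in> W. p w = q} \<in> I\<^sub>2"
proof -
  let ?C = "{e \<in> V - S. p e < k}"
  let ?J = "\<lambda>W. W \<subseteq> ?C \<and> (\<forall>q. M1.indep_over {e \<in> V. b e < q} ({e \<in> S. b e = q} \<union> {w \<in> W. p w = q}) \<and>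
      {s \<in> S. q < p s} \<union> {w \<in> W. p w = q} \<in> I\<^sub>2)"
  have "?J W" unfolding W_def
  proof (rule select_invariant)
    have "{s \<in> S. q < p s} \<in> I\<^sub>2" for q using M2.indep_subset[OF S_indep2] by auto
    then show "?J {}" using bid_indep by simp
  next
    fix A x assume A: "?J A" and x: "x \<in> set (list_by (\<lambda>_. 0) ?C)"
      and P: "insert x (below S p T A x) \<in> I\<^sub>1 \<and> insert x (above S p A x) \<in> I\<^sub>2"
    have xC: "x \<in> V" "x \<notin> S" "p x < k" using x set_candidates by auto
    show "?J (insert x A)"
    proof (cases "x \<in> A")
      case True then show ?thesis using A by (simp add: insert_absorb)
    next
      case False
      let ?X = "{e \<in> S. b e = p x} \<union> {w \<in> A. p w = p x}"
      have XV: "?X \<subseteq> V" using S_subset A by auto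
      have bx: "b x = p x" using xC by (simp add: bid_def)
      have "x \<notin> below S p T A x" using False xC bx by (auto simp: below_def)
      then have nx: "x \<notin> M1.cl (below S p T A x)"
        using P M1.insert_indep_iff[of "below S p T A x" x] xC
          M1.indep_subset[of "insert x (below S p T A x)" "below S p T A x"] by auto
      have sub: "{e \<in> V. b e < p x} \<union> ?X \<subseteq> M1.cl (below S p T A x)"
      proof -
        have "M1.cl {t \<in> T. b t < p x} \<subseteq> M1.cl (below S p T A x)"
          by (rule M1.cl_mono) (auto simp: below_def)
        moreover have "?X \<subseteq> below S p T A x" by (auto simp: below_def)
        then have "?X \<subseteq> M1.cl (below S p T A x)"
          using XV M1.cl_extensive[of _ "below S p T A x"] by blast
        moreover have "{e \<in> V. b e < p x} \<subseteq> M1.cl {t \<in> T. b t < p x}" using T_span xC by simp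
        ultimately show ?thesis by blast
      qed
      have "x \<notin> M1.cl ({e \<in> V. b e < p x} \<union> ?X)" using nx M1.cl_trans[OF sub] by auto
      then have 1: "M1.indep_over {e \<in> V. b e < p x} (insert x ?X)"
        using A XV xC by (intro M1.indep_over_insert) auto
      have 2: "insert x ({s \<in> S. p x < p s} \<union> {w \<in> A. p w = p x}) \<in> I\<^sub>2"
        using P by (simp add: above_def)
      have "M1.indep_over {e \<in> V. b e < q} ({e \<in> S. b e = q} \<union> {w \<in> insert x A. p w = q}) \<and>
          {s \<in> S. q < p s} \<union> {w \<in> insert x A. p w = q} \<in> I\<^sub>2" for q
      proof (cases "q = p x")
        case True
        then have "{w \<in> insert x A. p w = q} = insert x {w \<in> A. p w = p x}" by auto
        then show ?thesis using 1 2 True by simp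
      next
        case False
        then have "{w \<in> insert x A. p w = q} = {w \<in> A. p w = q}" by auto
        then show ?thesis using A by simp
      qed
      then show ?thesis using A xC by auto
    qed
  qed
  then show "M1.indep_over {e \<in> V. b e < q} ({e \<in> S. b e = q} \<union> {w \<in> W. p w = q})"
    "{s \<in> S. q < p s} \<union> {w \<in> W. p w = q} \<in> I\<^sub>2" by auto
qed

text \<open>A refused offer depended on what had been accepted by then, and closures only grow with
  \<open>W\<close>. The first alternative later saves rank in the first matroid, the second is the
  reason for a price rise.\<close>

lemma W_maximal:
  assumes e: "e \<in> V - S" "p e < k" "e \<notin> W"
  shows "e \<in> M1.cl ({x \<in> V. b x < p e} \<union> ({s \<in> S. b s = p e} \<union> {w \<in> W. p w = p e})) \<or>
    e \<in> M2.cl (above S p W e)"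
proof -
  have "e \<in> set (list_by (\<lambda>_. 0) {e \<in> V - S. p e < k})" using e set_candidates by auto
  then obtain B ys zs where "list_by (\<lambda>_. 0) {e \<in> V - S. p e < k} = ys @ e # zs" "B \<subseteq> W" "{} \<subseteq> B"
    "B \<subseteq> {} \<union> set ys" and n: "\<not> (insert e (below S p T B e) \<in> I\<^sub>1 \<and> insert e (above S p B e) \<in> I\<^sub>2)"
    using e(3) unfolding W_def by (rule select_rejected)
  have be: "b e = p e" using e by (simp add: bid_def)
  show ?thesis
  proof (cases "insert e (below S p T B e) \<in> I\<^sub>1")
    case False
    let ?X = "{s \<in> S. b s = p e} \<union> {w \<in> B. p w = p e}"
    \<comment> \<open>The tested set \<open>below S p T B e\<close> is itself independent, so the
      refusal means that it spans \<open>e\<close>.\<close>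
    have TJ: "{t \<in> T. b t < p e} \<in> I\<^sub>1" using M1.indep_subset[OF T_indep] by auto
    have "M1.indep_over {x \<in> V. b x < p e} ?X"
      by (rule M1.indep_over_mono[OF W_indep1[of "p e"]]) (use \<open>B \<subseteq> W\<close> in auto)
    then have "{t \<in> T. b t < p e} \<union> ?X \<in> I\<^sub>1"
      using T_subset S_subset \<open>B \<subseteq> W\<close> W_subset by (intro M1.indep_over_indep_Un[OF TJ]) auto
    then have "below S p T B e \<in> I\<^sub>1" by (simp add: below_def Un_assoc)
    moreover have "e \<notin> below S p T B e" using e be \<open>B \<subseteq> W\<close> by (auto simp: below_def)
    ultimately have "e \<in> M1.cl (below S p T B e)" using False M1.insert_indep_iff[of _ e] e(1) by auto
    then have "e \<in> M1.cl ({x \<in> V. b x < p e} \<union> ({s \<in> S. b s = p e} \<union> {w \<in> W. p w = p e}))"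
      by (rule M1.cl_mono') (use \<open>B \<subseteq> W\<close> T_subset in \<open>auto simp: below_def\<close>)
    then show ?thesis ..
  next
    case True
    have sub: "above S p B e \<subseteq> above S p W e" using \<open>B \<subseteq> W\<close> by (auto simp: above_def)
    have "above S p B e \<in> I\<^sub>2" using M2.indep_subset[OF W_indep2[of "p e"]] sub by (simp add: above_def)
    moreover have "e \<notin> above S p B e" using e \<open>B \<subseteq> W\<close> by (auto simp: above_def)
    ultimately have "e \<in> M2.cl (above S p B e)" using True n M2.insert_indep_iff[of _ e] e(1) by auto
    then show ?thesis using M2.cl_mono[OF sub] by auto
  qed
qed

end

context auction_round
begin

definition p' :: "'a \<Rightarrow> nat" where
  "p' e = (if e \<in> W \<or> (e \<in> V - S \<and> p e < k \<and> insert e (above S p W e) \<notin> I\<^sub>2) then p e + 1 else p e)"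

text \<open>Prices never exceed \<open>k\<close>, so the key \<open>k - p' e\<close> sorts by
  decreasing price and the result is a maximum-price basis of \<open>S \<union> W\<close>.\<close>

definition S' :: "'a set" where
  "S' = select (\<lambda>B e. insert e B \<in> I\<^sub>2) (list_by (\<lambda>e. k - p' e) (S \<union> W)) {}"

lemma W_D: "w \<in> W \<Longrightarrow> w \<in> V \<and> w \<notin> S \<and> p w < k"
  using W_subset by auto

lemma W_subset_V: "W \<subseteq> V"
  using W_D by blast

lemma p'_on_S: "e \<in> S \<Longrightarrow> p' e = p e"
  using W_D[of e] by (auto simp: p'_def)

lemma p'_on_W: "e \<in> W \<Longrightarrow> p' e = p e + 1"
  by (simp add: p'_def)

lemma p'_ge: "p e \<le> p' e"
  by (simp add: p'_def)

lemma p'_le: "e \<in> V \<Longrightarrow> p' e \<le> k"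
  using price_le[of e] W_D[of e] by (auto simp: p'_def)

lemma finite_SW: "finite (S \<union> W)" and SW_subset: "S \<union> W \<subseteq> V"
  using W_subset_V S_subset finite_subset[OF _ M1.finite_V] by auto

lemma S'_indep: "S' \<in> I\<^sub>2" and S'_subset: "S' \<subseteq> S \<union> W"
  unfolding S'_def using M2.greedy[OF finite_SW SW_subset] by auto

lemma S'_span: "{e \<in> S \<union> W. q \<le> p' e} \<subseteq> M2.cl {e \<in> S'. q \<le> p' e}"
proof (cases "q \<le> k")
  case True
  have *: "q \<le> p' e \<longleftrightarrow> k - p' e \<le> k - q" if "e \<in> S \<union> W" for e
    using p'_le[of e] SW_subset that True by auto
  have "{e \<in> S \<union> W. k - p' e \<le> k - q} \<subseteq> M2.cl {e \<in> S'. k - p' e \<le> k - q}"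
    unfolding S'_def by (rule M2.greedy(3)[OF finite_SW SW_subset])
  moreover have "{e \<in> S \<union> W. k - p' e \<le> k - q} = {e \<in> S \<union> W. q \<le> p' e}" using * by auto
  moreover have "{e \<in> S'. k - p' e \<le> k - q} = {e \<in> S'. q \<le> p' e}" using * S'_subset by auto
  ultimately show ?thesis by simp
next
  case False
  have "\<not> q \<le> p' e" if "e \<in> S \<union> W" for e
    using p'_le[of e] SW_subset that False by auto
  then show ?thesis by blast
qed

text \<open>Two unit shifts cancel: the price of a winner rises by one, and membership in the
  solution subtracts one. So the new solution keeps the old bids, and its condition in the first
  matroid is inherited.\<close>

lemma bid'_on_S': "e \<in> S' \<Longrightarrow> bid S' p' e = b e"
  using S'_subset p'_on_S[of e] p'_on_W[of e] W_D[of e] by (auto simp: bid_def)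

lemma bid'_off_S': "e \<notin> S' \<Longrightarrow> bid S' p' e = p' e"
  by (simp add: bid_def)

lemma bid'_ge: "b e \<le> bid S' p' e"
proof (cases "e \<in> S'")
  case False
  then show ?thesis using bid_le[of e] p'_ge[of e] bid'_off_S' by simp
qed (simp add: bid'_on_S')

lemma above_in_cl_iff:
  assumes "e \<in> V - S" "e \<notin> W"
  shows "insert e (above S p W e) \<notin> I\<^sub>2 \<longleftrightarrow> e \<in> M2.cl (above S p W e)"
proof -
  have "above S p W e \<in> I\<^sub>2" using W_indep2[of "p e"] by (simp add: above_def)
  moreover have "e \<notin> above S p W e" using assms by (auto simp: above_def)
  ultimately show ?thesis using M2.insert_indep_iff[of _ e] assms by auto
qed

text \<open>\<open>S'\<close> spans \<open>S \<union> W\<close> at every threshold, so it suffices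
  to span by the latter. A loser whose price rose is spanned by \<open>above\<close>, whose members
  all have a new price of at least \<open>p e + 1\<close>.\<close>

lemma price_span': "{e \<in> V. q \<le> p' e} \<subseteq> M2.cl {e \<in> S'. q \<le> p' e}" if "1 \<le> q"
proof
  fix e assume "e \<in> {e \<in> V. q \<le> p' e}"
  then have e: "e \<in> V" "q \<le> p' e" by auto
  have "e \<in> M2.cl {e \<in> S \<union> W. q \<le> p' e}"
  proof (cases "q \<le> p e")
    case True
    then have "e \<in> M2.cl {e \<in> S. q \<le> p e}" using price_span[OF \<open>1 \<le> q\<close>] e by auto
    moreover have "{e \<in> S. q \<le> p e} \<subseteq> {e \<in> S \<union> W. q \<le> p' e}" using p'_on_S by auto
    ultimately show ?thesis by (rule M2.cl_mono')
  next
    case False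
    then have raised: "p' e = p e + 1" "q = p e + 1" using e by (auto simp: p'_def split: if_splits)
    show ?thesis
    proof (cases "e \<in> W")
      case True
      then show ?thesis using e by (intro M2.cl_extensive) auto
    next
      case False
      then have "e \<in> V - S" "insert e (above S p W e) \<notin> I\<^sub>2"
        using raised(1) by (auto simp: p'_def split: if_splits)
      then have "e \<in> M2.cl (above S p W e)" using above_in_cl_iff False by simp
      moreover have "above S p W e \<subseteq> {e \<in> S \<union> W. q \<le> p' e}"
        using p'_on_S p'_on_W raised by (auto simp: above_def)
      ultimately show ?thesis by (rule M2.cl_mono')
    qed
  qed
  then show "e \<in> M2.cl {e \<in> S'. q \<le> p' e}" by (rule M2.cl_subset_cl[OF S'_span])
qed

lemma auction_inv': "auction_inv k S' p'"
  unfolding auction_inv_def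
proof (intro conjI ballI allI impI)
  show "S' \<subseteq> V" using S'_subset SW_subset by (rule subset_trans)
  show "S' \<in> I\<^sub>2" by (rule S'_indep)
  show "1 \<le> p' e" if "e \<in> S'" for e
  proof (cases "e \<in> S")
    case True then show ?thesis using price_pos[of e] p'_on_S by simp
  next
    case False then show ?thesis using that S'_subset p'_on_W[of e] by auto
  qed
  show "p' e \<le> k" if "e \<in> V" for e using that by (rule p'_le)
  show "{e \<in> V. q \<le> p' e} \<subseteq> M2.cl {e \<in> S'. q \<le> p' e}" if "1 \<le> q" for q
    using that by (rule price_span')
  show "M1.indep_over {e \<in> V. bid S' p' e < q} {e \<in> S'. bid S' p' e = q}" for q
  proof (rule M1.indep_over_mono[OF W_indep1[of q]])
    show "{e \<in> V. bid S' p' e < q} \<subseteq> {e \<in> V. b e < q}" using bid'_ge by (auto intro: le_less_trans)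
    show "{e \<in> S'. bid S' p' e = q} \<subseteq> {e \<in> S. b e = q} \<union> {w \<in> W. p w = q}"
    proof
      fix e assume "e \<in> {e \<in> S'. bid S' p' e = q}"
      then have "e \<in> S'" "b e = q" using bid'_on_S' by auto
      then show "e \<in> {e \<in> S. b e = q} \<union> {w \<in> W. p w = q}"
        using S'_subset W_D[of e] by (auto simp: bid_def)
    qed
  qed
qed

text \<open>Apart from lower bids and the counted elements of \<open>S\<close> and \<open>W\<close>,
  only candidates whose price did not rise still bid at most \<open>q\<close>. The second matroid
  does not refuse these, so the first one does: they are spanned and add no rank.\<close>

lemma rk1_drop:
  assumes "q < k"
  shows "M1.rk {e \<in> V. bid S' p' e \<le> q} \<le> M1.rk {e \<in> V. b e < q} + card {e \<in> S. b e = q} + card {w \<in> W. p w = q}"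
proof -
  let ?X = "{e \<in> S. b e = q} \<union> {w \<in> W. p w = q}"
  have XV: "?X \<subseteq> V" using S_subset W_subset_V by auto
  have "{e \<in> V. bid S' p' e \<le> q} \<subseteq> M1.cl ({e \<in> V. b e < q} \<union> ?X)"
  proof
    fix e assume "e \<in> {e \<in> V. bid S' p' e \<le> q}"
    then have e: "e \<in> V" "bid S' p' e \<le> q" by auto
    then have le: "b e \<le> q" using bid'_ge[of e] by simp
    show "e \<in> M1.cl ({e \<in> V. b e < q} \<union> ?X)"
    proof (cases "e \<in> {e \<in> V. b e < q} \<union> ?X")
      case True
      then show ?thesis using e by (intro M1.cl_extensive)
    next
      case False
      then have eS: "b e = q" "e \<notin> S" using le e(1) by auto
      then have pe: "p e = q" by (simp add: bid_def)
      then have eW: "e \<notin> W" using False by auto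
      then have "e \<notin> S'" using eS S'_subset by auto
      then have "p' e \<noteq> p e + 1" using e(2) pe bid'_off_S'[of e] by simp
      then have "insert e (above S p W e) \<in> I\<^sub>2" using e eS pe assms by (auto simp: p'_def split: if_splits)
      then show ?thesis using W_maximal[of e] above_in_cl_iff[of e] e eS pe eW assms by simp
    qed
  qed
  then have "M1.rk {e \<in> V. bid S' p' e \<le> q} \<le> M1.rk ({e \<in> V. b e < q} \<union> ?X)"
    by (rule M1.rk_le_of_subset_cl)
  also have "\<dots> = M1.rk {e \<in> V. b e < q} + card ?X"
    by (rule M1.rk_indep_over[OF finite_subset[OF XV M1.finite_V] XV W_indep1])
  also have "card ?X \<le> card {e \<in> S. b e = q} + card {w \<in> W. p w = q}" by (rule card_Un_le)
  finally show ?thesis by simp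
qed

lemma rk2_gain: "M2.rk {e \<in> V. q < p e} + card {w \<in> W. p w = q} \<le> M2.rk {e \<in> V. q < p' e}"
proof -
  let ?Y = "{s \<in> S. q < p s}" and ?W = "{w \<in> W. p w = q}"
  have fin: "finite ?Y" "finite ?W" using finite_SW by auto
  have "{e \<in> V. q < p e} \<subseteq> M2.cl ?Y" using price_span[of "Suc q"] by (simp add: Suc_le_eq)
  then have "M2.rk {e \<in> V. q < p e} \<le> M2.rk ?Y" by (rule M2.rk_le_of_subset_cl)
  also have "\<dots> \<le> card ?Y" using fin(1) by (rule M2.rk_le_card)
  finally have "M2.rk {e \<in> V. q < p e} + card ?W \<le> card ?Y + card ?W" by simp
  also have "\<dots> = card (?Y \<union> ?W)" using fin W_D by (subst card_Un_disjoint) auto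
  also have "\<dots> \<le> M2.rk {e \<in> V. q < p' e}"
  proof (rule M2.card_le_rk[OF W_indep2])
    have "{s \<in> S. q < p s} \<subseteq> {e \<in> V. q < p' e}" using p'_on_S S_subset by auto
    moreover have "{w \<in> W. p w = q} \<subseteq> {e \<in> V. q < p' e}" using p'_on_W W_subset_V by auto
    ultimately show "?Y \<union> ?W \<subseteq> {e \<in> V. q < p' e}" by simp
  qed
  finally show ?thesis .
qed

text \<open>Unassigned elements either win, which raises the second rank sum, or lose all their offers at the
  current level, which lowers the first one.\<close>

lemma potential_decrease:
  assumes m: "\<And>J. J \<in> I\<^sub>2 \<Longrightarrow> card J \<le> m"
  shows "potential m k S' p' + card T \<le> potential m k S p + card S"
proof -
  let ?r2 = "\<lambda>q. M2.rk {e \<in> V. q < p e}" and ?r2' = "\<lambda>q. M2.rk {e \<in> V. q < p' e}"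
  let ?r1 = "\<lambda>q. M1.rk {e \<in> V. b e < q}" and ?w = "\<lambda>q. card {w \<in> W. p w = q}"
  have rkm: "M2.rk A \<le> m" for A using m M2.rk_witness[of A] by metis
  have finW: "finite W" using finite_SW by simp
  have W: "(\<Sum>q<k. ?w q) = card W" using W_D by (intro sum_levels[OF finW]) auto
  have S: "(\<Sum>q<k. card {e \<in> S. b e = q}) = card S" by (intro sum_levels[OF finite_S] bid_less)
  have "(\<Sum>q<k. m - ?r2' q) + card W = (\<Sum>q<k. (m - ?r2' q) + ?w q)" by (simp add: sum.distrib W)
  also have "\<dots> \<le> (\<Sum>q<k. m - ?r2 q)"
  proof (rule sum_mono)
    fix q
    show "(m - ?r2' q) + ?w q \<le> m - ?r2 q"
      using rk2_gain[of q] rkm[of "{e \<in> V. q < p' e}"] by linarith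
  qed
  finally have 2: "(\<Sum>q<k. m - ?r2' q) + card W \<le> (\<Sum>q<k. m - ?r2 q)" .
  have "(\<Sum>q<k. M1.rk {e \<in> V. bid S' p' e \<le> q}) \<le> (\<Sum>q<k. ?r1 q + card {e \<in> S. b e = q} + ?w q)"
    by (rule sum_mono) (use rk1_drop in simp)
  also have "\<dots> = (\<Sum>q<k. ?r1 q) + card S + card W" by (simp add: sum.distrib W S)
  finally have 1: "(\<Sum>q<k. M1.rk {e \<in> V. bid S' p' e \<le> q}) \<le> (\<Sum>q<k. ?r1 q) + card S + card W" .
  \<comment> \<open>The new bids at most \<open>q\<close> were compared with old bids below
    \<open>q\<close>, one level lower. The shift telescopes to \<open>?r1 k\<close>, which is
    \<open>card T\<close>. Since \<open>card W\<close> cancels between the two sums, the net drop is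
    at least \<open>card T - card S\<close>.\<close>
  have "?r1 0 = 0" using M1.rk_le_card[of "{}"] by simp
  then have "(\<Sum>q<k. ?r1 q) + ?r1 k = (\<Sum>q<k. ?r1 (Suc q))"
    using sum.lessThan_Suc_shift[of ?r1 k] by simp
  then have "(\<Sum>q<k. ?r1 q) + card T = (\<Sum>q<k. M1.rk {e \<in> V. b e \<le> q})"
    by (simp add: card_T less_Suc_eq_le)
  then show ?thesis using 1 2 unfolding potential_def by linarith
qed

end

context two_matroids
begin

text \<open>A round makes four scans of at most \<open>2 * card V\<close> queries. Unless it stops,
  \<open>card T\<close> exceeds \<open>card S\<close> by at least \<open>d + 1\<close> and the
  potential falls by as much, so the rounds cannot run out; for \<open>N = 0\<close> the bound on
  the potential is contradictory.\<close>

lemma wp_auction: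
  assumes "auction_inv k S p" "potential m k S p < N * (d + 1)"
    and m: "\<And>J. J \<in> I\<^sub>2 \<Longrightarrow> card J \<le> m"
    and Q: "\<And>S c'. S \<in> I\<^sub>1 \<Longrightarrow> S \<in> I\<^sub>2 \<Longrightarrow>
       (\<And>J. J \<in> I\<^sub>1 \<Longrightarrow> J \<in> I\<^sub>2 \<Longrightarrow> k * card J \<le> k * (card S + d) + card S) \<Longrightarrow>
       c' \<le> c + N * (8 * card V) \<Longrightarrow> Q S c'"
  shows "wp V query (auction V k d N S p) c Q"
  using assms(1,2) Q
proof (induction N arbitrary: S p c)
  case (Suc N)
  interpret auction_state V I\<^sub>1 I\<^sub>2 k S p using Suc.prems(1) by unfold_locales
  let ?B = "{e \<in> V. b e < k}" and ?C = "{e \<in> V - S. p e < k}"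
  let ?n = "card V"
  define T where "T = select (\<lambda>B x. insert x B \<in> I\<^sub>1) (list_by b ?B) {}"
  have B: "finite ?B" "?B \<subseteq> V" and C: "finite ?C" "?C \<subseteq> V" using M1.finite_V by auto
  have cards: "card ?B \<le> ?n" "card ?C \<le> ?n" using B C M1.finite_V card_mono by blast+
  have T: "T \<in> I\<^sub>1" "T \<subseteq> ?B" "\<And>q. {x \<in> ?B. b x \<le> q} \<subseteq> M1.cl {x \<in> T. b x \<le> q}"
    unfolding T_def using M1.greedy[OF B] by auto
  have T_span: "{e \<in> V. b e < q} \<subseteq> M1.cl {t \<in> T. b t < q}" if "q \<le> k" for q
  proof (cases q)
    case (Suc q')
    then have "{e \<in> V. b e < q} = {x \<in> ?B. b x \<le> q'}" using that by auto
    then show ?thesis using T(3)[of q'] Suc by (simp add: less_Suc_eq_le)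
  qed simp
  show ?case
    unfolding auction.simps(2)
  proof (rule wp_scan_bind[where R = T and l = ?n])
    show "select (\<lambda>A x. query True (insert x A) \<and> query False {}) (list_by b ?B) {} = T"
      by (simp add: T_def)
  next
    fix c1 assume c1: "c1 \<le> c + 2 * ?n"
    show "wp V query (if card T \<le> card S + d then Return S else
       let xs = list_by (\<lambda>_. 0) ?C in
       bind (scan (\<lambda>W e. insert e (below S p T W e)) (\<lambda>W e. insert e (above S p W e)) xs {}) (\<lambda>W.
       bind (scan (\<lambda>_ _. {}) (\<lambda>_ e. insert e (above S p W e)) xs {}) (\<lambda>N'.
       let p' = (\<lambda>e. if e \<in> W \<or> (e \<in> V - S \<and> p e < k \<and> e \<notin> N') then p e + 1 else p e) in
       bind (scan (\<lambda>_ _. {}) (\<lambda>B e. insert e B) (list_by (\<lambda>e. k - p' e) (S \<union> W)) {}) (\<lambda>S'.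
       auction V k d N S' p')))) c1 Q"
    proof (cases "card T \<le> card S + d")
      case True
      have "{t \<in> T. b t < k} = T" using T(2) by auto
      then have "M1.rk ?B \<le> card T"
        using M1.rk_le_of_subset_cl[OF T_span[of k]] M1.rk_indep[OF T(1)] by simp
      then have le: "k * M1.rk ?B \<le> k * (card S + d)" using True by (intro mult_le_mono2) simp
      have "Q S c1"
      proof (rule Suc.prems(3)[OF S_indep1 S_indep2])
        show "k * card J \<le> k * (card S + d) + card S" if "J \<in> I\<^sub>1" "J \<in> I\<^sub>2" for J
          using common_indep_bound[OF that] le by linarith
        show "c1 \<le> c + Suc N * (8 * ?n)" using c1 by simp
      qed
      then show ?thesis using True by simp
    next
      case False
      define W where "W = select (\<lambda>W e. insert e (below S p T W e) \<in> I\<^sub>1 \<and> insert e (above S p W e) \<in> I\<^sub>2)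
        (list_by (\<lambda>_. 0) ?C) {}"
      interpret auction_round V I\<^sub>1 I\<^sub>2 k S p T W
        using T(1,2) T_span by unfold_locales (simp_all add: W_def)
      define N' where "N' = select (\<lambda>_ e. insert e (above S p W e) \<in> I\<^sub>2) (list_by (\<lambda>_. 0) ?C) {}"
      have N': "N' = {e \<in> ?C. insert e (above S p W e) \<in> I\<^sub>2}"
        unfolding N'_def select_filter set_candidates by simp
      have p': "(\<lambda>e. if e \<in> W \<or> (e \<in> V - S \<and> p e < k \<and> e \<notin> N') then p e + 1 else p e) = p'"
        unfolding N' p'_def by (intro ext) auto
      have "card (S \<union> W) \<le> ?n" by (rule card_mono[OF M1.finite_V SW_subset])
      note lengths = this cards(2) list_by(3)[OF C(1)] list_by(3)[OF finite_SW]
      have set_SW: "set (list_by w (S \<union> W)) = S \<union> W" for w by (rule list_by(1)[OF finite_SW])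
      have above_V: "above S p A x \<subseteq> V" if "A \<subseteq> V" for A x
        using that S_subset by (auto simp: above_def)
      have below_V: "below S p T A x \<subseteq> V" if "A \<subseteq> V" for A x
        using that S_subset T(2) by (auto simp: below_def)
      have "wp V query (bind (scan (\<lambda>W e. insert e (below S p T W e)) (\<lambda>W e. insert e (above S p W e))
          (list_by (\<lambda>_. 0) ?C) {}) (\<lambda>W.
          bind (scan (\<lambda>_ _. {}) (\<lambda>_ e. insert e (above S p W e)) (list_by (\<lambda>_. 0) ?C) {}) (\<lambda>N'.
          let p' = (\<lambda>e. if e \<in> W \<or> (e \<in> V - S \<and> p e < k \<and> e \<notin> N') then p e + 1 else p e) in
          bind (scan (\<lambda>_ _. {}) (\<lambda>B e. insert e B) (list_by (\<lambda>e. k - p' e) (S \<union> W)) {}) (\<lambda>S'.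
          auction V k d N S' p')))) c1 Q"
      proof (rule wp_scan_bind[where R = W and l = ?n])
        fix c2 assume c2: "c2 \<le> c1 + 2 * ?n"
        show "wp V query (bind (scan (\<lambda>_ _. {}) (\<lambda>_ e. insert e (above S p W e)) (list_by (\<lambda>_. 0) ?C) {}) (\<lambda>N'.
          let p' = (\<lambda>e. if e \<in> W \<or> (e \<in> V - S \<and> p e < k \<and> e \<notin> N') then p e + 1 else p e) in
          bind (scan (\<lambda>_ _. {}) (\<lambda>B e. insert e B) (list_by (\<lambda>e. k - p' e) (S \<union> W)) {}) (\<lambda>S'.
          auction V k d N S' p'))) c2 Q"
        proof (rule wp_scan_bind[where R = N' and l = ?n])
          fix c3 assume c3: "c3 \<le> c2 + 2 * ?n"
          have "wp V query (bind (scan (\<lambda>_ _. {}) (\<lambda>B e. insert e B) (list_by (\<lambda>e. k - p' e) (S \<union> W)) {}) (\<lambda>S'.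
            auction V k d N S' p')) c3 Q"
          proof (rule wp_scan_bind[where R = S' and l = ?n])
            fix c4 assume c4: "c4 \<le> c3 + 2 * ?n"
            show "wp V query (auction V k d N S' p') c4 Q"
            proof (rule Suc.IH[OF auction_inv'])
              show "potential m k S' p' < N * (d + 1)"
                using potential_decrease[OF m] False Suc.prems(2) by simp
              show "Q A c'" if "A \<in> I\<^sub>1" "A \<in> I\<^sub>2"
                "\<And>J. J \<in> I\<^sub>1 \<Longrightarrow> J \<in> I\<^sub>2 \<Longrightarrow> k * card J \<le> k * (card A + d) + card A"
                "c' \<le> c4 + N * (8 * ?n)" for A c'
                using that c1 c2 c3 c4 by (intro Suc.prems(3)) simp_all
            qed
          qed (use lengths set_SW SW_subset in \<open>auto simp: S'_def\<close>)
          then show "wp V query (let p' = (\<lambda>e. if e \<in> W \<or> (e \<in> V - S \<and> p e < k \<and> e \<notin> N') then p e + 1 else p e) in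
            bind (scan (\<lambda>_ _. {}) (\<lambda>B e. insert e B) (list_by (\<lambda>e. k - p' e) (S \<union> W)) {}) (\<lambda>S'.
            auction V k d N S' p')) c3 Q" unfolding p' Let_def .
        qed (use lengths set_candidates above_V[OF W_subset_V] in \<open>auto simp: N'_def\<close>)
      qed (use lengths set_candidates above_V below_V in \<open>auto simp: W_def\<close>)
      then show ?thesis using False by (simp only: Let_def if_False)
    qed
  qed (use list_by[OF B(1)] cards in auto)
qed simp

end

section \<open>Augmenting paths\<close>

primrec bsearch :: "'a set \<Rightarrow> 'a \<Rightarrow> nat \<Rightarrow> 'a list \<Rightarrow> ('a, 'a) prog" where
  "bsearch S x 0 L = Return (hd L)"
| "bsearch S x (Suc j) L = Ask False (insert x (S - set (take (2 ^ j) L)))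
     (\<lambda>b. bsearch S x j (if b then take (2 ^ j) L else drop (2 ^ j) L))"

text \<open>\<open>x\<close> leaves the list only when \<open>B\<close> contains its whole circuit.
  Successful tests are thus paid for by new elements of \<open>S\<close>, failed ones by elements of
  the list.\<close>

primrec expand :: "'a set \<Rightarrow> nat \<Rightarrow> nat \<Rightarrow> 'a list \<Rightarrow> 'a set \<Rightarrow> ('a, 'a set) prog" where
  "expand S j 0 xs B = Return B"
| "expand S j (Suc f) xs B = (case xs of [] \<Rightarrow> Return B
     | x # xs' \<Rightarrow> Ask False (insert x B) (\<lambda>b.
         if b then bind (bsearch S x j (list_by (\<lambda>_. 0) (S - B))) (\<lambda>y. expand S j f xs (insert y B))
         else expand S j f xs' B))"

text \<open>No predecessors are stored. When the recursion returns the rest of a path, two scans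
  link its head to the present layer.\<close>

primrec augment :: "'a set \<Rightarrow> nat \<Rightarrow> 'a set \<Rightarrow> 'a set \<Rightarrow> nat \<Rightarrow> 'a set \<Rightarrow> ('a, ('a list \<times> 'a list) option) prog" where
  "augment V j S F 0 B = Return None"
| "augment V j S F (Suc f) B =
     bind (scan (\<lambda>_ x. insert x (S - B)) (\<lambda>_ _. {}) (list_by (\<lambda>_. 0) (V - S)) {}) (\<lambda>A.
     if A \<inter> F \<noteq> {} then Return (Some ([SOME x. x \<in> A \<inter> F], [])) else
     bind (expand S j (card V + card S) (list_by (\<lambda>_. 0) A) B) (\<lambda>B'.
     if B' = B then Return None else
     bind (augment V j S F f B') (\<lambda>res. case res of None \<Rightarrow> Return None | Some (xs, ys) \<Rightarrow>
       bind (scan (\<lambda>_ y. insert (hd xs) (S - {y})) (\<lambda>_ _. {}) (list_by (\<lambda>_. 0) (B' - B)) {}) (\<lambda>Y.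
       bind (scan (\<lambda>_ _. {}) (\<lambda>_ x. insert x (S - {SOME y. y \<in> Y})) (list_by (\<lambda>_. 0) A) {}) (\<lambda>X.
       Return (Some ((SOME x. x \<in> X) # xs, (SOME y. y \<in> Y) # ys)))))))"

primrec intersect :: "'a set \<Rightarrow> nat \<Rightarrow> nat \<Rightarrow> 'a set \<Rightarrow> ('a, 'a set) prog" where
  "intersect V j 0 S = Return S"
| "intersect V j (Suc f) S =
     bind (scan (\<lambda>_ _. {}) (\<lambda>_ x. insert x S) (list_by (\<lambda>_. 0) (V - S)) {}) (\<lambda>F.
     bind (augment V j S F (Suc (card S)) {}) (\<lambda>res. case res of None \<Rightarrow> Return S
       | Some (xs, ys) \<Rightarrow> intersect V j f (S - set ys \<union> set xs)))"

section \<open>Shortest augmenting paths in the exchange graph\<close>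

locale common_indep = two_matroids V I\<^sub>1 I\<^sub>2 for V :: "'a set" and I\<^sub>1 I\<^sub>2 +
  fixes S :: "'a set"
  assumes S1: "S \<in> I\<^sub>1" and S2: "S \<in> I\<^sub>2"
begin

lemma SV: "S \<subseteq> V" and finS: "finite S"
  using M1.indep_subset_V[OF S1] M1.finite_indep[OF S1] by auto

definition F :: "'a set" where "F = {x \<in> V - S. insert x S \<in> I\<^sub>2}"

text \<open>By the circuit criterion, \<open>x\<close> is in it if it extends \<open>S\<close> in
  the first matroid or its circuit meets \<open>B\<close>. One query thus examines all edges between
  \<open>B\<close> and \<open>x\<close>.\<close>

definition reach :: "'a set \<Rightarrow> 'a set" where
  "reach B = {x \<in> V - S. insert x (S - B) \<in> I\<^sub>1}"

text \<open>Breadth-first search in the exchange graph: \<open>layers i\<close> and \<open>reach (layers i)\<close> are the elements of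
  \<open>S\<close> and of \<open>V - S\<close> at distance at most \<open>2 i - 1\<close> and \<open>2 i\<close> from the sources.\<close>

primrec layers :: "nat \<Rightarrow> 'a set" where
  "layers 0 = {}"
| "layers (Suc i) = layers i \<union> (\<Union>x\<in>reach (layers i). M2.circ S x)"

lemma layers_subset: "layers i \<subseteq> S"
  by (induction i) (use M2.circ_subset in auto)

lemma layers_mono: "i \<le> l \<Longrightarrow> layers i \<subseteq> layers l"
  by (rule lift_Suc_mono_le[of layers]) auto

lemma in_cl1_iff: "x \<in> V - S \<Longrightarrow> x \<in> M1.cl (S - B) \<longleftrightarrow> x \<notin> reach B"
  using M1.insert_indep_iff[of "S - B" x] M1.indep_subset[OF S1, of "S - B"]
  by (auto simp: reach_def)

lemma in_cl2_iff: "x \<in> V - S \<Longrightarrow> x \<in> M2.cl S \<longleftrightarrow> x \<notin> F"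
  using M2.insert_indep_iff[OF S2, of x] by (auto simp: F_def)

lemma circ2_subset_layers: "x \<in> reach (layers i) \<Longrightarrow> M2.circ S x \<subseteq> layers (Suc i)"
  by auto

text \<open>Outside \<open>S\<close>, an element not in \<open>reach\<close> is spanned in the first
  matroid by \<open>S - layers l\<close>. An element in \<open>reach\<close> is no sink, so in the
  second matroid it is spanned by its circuit, which lies in the next layer set.\<close>

lemma cut_bound:
  assumes J: "J \<in> I\<^sub>1" "J \<in> I\<^sub>2" and noF: "reach (layers l) \<inter> F = {}"
  shows "card J \<le> card (S - layers l) + card (layers (Suc l))"
proof -
  have "J \<subseteq> M1.cl (S - layers l) \<union> M2.cl (layers (Suc l))"
  proof
    fix v assume "v \<in> J"
    then have v: "v \<in> V" using M1.indep_subset_V[OF J(1)] by auto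
    show "v \<in> M1.cl (S - layers l) \<union> M2.cl (layers (Suc l))"
    proof (cases "v \<in> S")
      case True
      then show ?thesis
        using v M1.cl_extensive[of v "S - layers l"] M2.cl_extensive[of v "layers (Suc l)"] by auto
    next
      case False
      show ?thesis
      proof (cases "v \<in> reach (layers l)")
        case True
        then have "v \<in> M2.cl S" using noF in_cl2_iff[of v] v False by auto
        then have "v \<in> M2.cl (layers (Suc l))"
          using M2.in_cl_iff_circ_subset[OF S2 _ layers_subset, of v "Suc l"] circ2_subset_layers[OF True]
          by (simp del: layers.simps)
        then show ?thesis ..
      next
        case False
        then show ?thesis using in_cl1_iff[of v] v \<open>v \<notin> S\<close> by auto
      qed
    qed
  qed
  then have "card J \<le> M1.rk (M1.cl (S - layers l)) + M2.rk (M2.cl (layers (Suc l)))"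
    by (rule common_le_rk[OF J])
  also have "\<dots> \<le> M1.rk (S - layers l) + M2.rk (layers (Suc l))"
    by (intro add_mono M1.rk_le_of_subset_cl M2.rk_le_of_subset_cl order_refl)
  also have "\<dots> \<le> card (S - layers l) + card (layers (Suc l))"
    by (intro add_mono M1.rk_le_card M2.rk_le_card finite_subset[OF layers_subset finS] finite_Diff finS)
  finally show ?thesis .
qed

lemma card_layers_le: "card (layers i) \<le> card S"
  by (rule card_mono[OF finS layers_subset])

lemma card_Diff_layers: "card (S - layers l) = card S - card (layers l)"
  by (rule card_Diff_subset[OF finite_subset[OF layers_subset finS] layers_subset])

lemma maximum_if_stuck:
  assumes "J \<in> I\<^sub>1" "J \<in> I\<^sub>2" "reach (layers l) \<inter> F = {}" "layers (Suc l) = layers l"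
  shows "card J \<le> card S"
  using cut_bound[OF assms(1-3)] card_layers_le[of l] unfolding card_Diff_layers assms(4) by linarith

text \<open>Summing the cuts between consecutive layers bounds the length of a shortest augmenting path.\<close>

lemma path_length_bound:
  assumes J: "J \<in> I\<^sub>1" "J \<in> I\<^sub>2" and noF: "\<And>l. l < n \<Longrightarrow> reach (layers l) \<inter> F = {}"
  shows "n * card J \<le> n * card S + card S"
proof -
  have "n * card J \<le> n * card S + card (layers n)"
    using noF
  proof (induction n)
    case (Suc n)
    have "n * card J \<le> n * card S + card (layers n)" using Suc by simp
    moreover have "card J \<le> card (S - layers n) + card (layers (Suc n))"
      using cut_bound[OF J, of n] Suc.prems by simp
    ultimately show ?case using card_layers_le[of n] card_Diff_layers[of n] by simp
  qed simp
  then show ?thesis using card_layers_le[of n] by linarith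
qed

text \<open>The index \<open>i\<close> allows for the part of a path from layer \<open>i\<close> on,
  as the recursion returns it. Each vertex occurs in the first layer that reaches it and no sink is
  reached earlier: this is how shortness is recorded.\<close>

definition is_path :: "nat \<Rightarrow> 'a list \<Rightarrow> 'a list \<Rightarrow> bool" where
  "is_path i xs ys \<longleftrightarrow> length xs = Suc (length ys) \<and>
     (\<forall>l<length xs. xs ! l \<in> reach (layers (i + l)) \<and> (\<forall>h<i + l. xs ! l \<notin> reach (layers h))) \<and>
     xs ! length ys \<in> F \<and>
     (\<forall>l<length ys. ys ! l \<in> layers (Suc (i + l)) - layers (i + l) \<and>
        ys ! l \<in> M1.circ S (xs ! Suc l) \<and> ys ! l \<in> M2.circ S (xs ! l)) \<and>
     (\<forall>h<i + length ys. reach (layers h) \<inter> F = {})"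

lemma is_path_Cons:
  assumes path: "is_path (Suc i) xs ys" and "x \<in> reach (layers i)" "\<forall>h<i. x \<notin> reach (layers h)"
    and "y \<in> layers (Suc i) - layers i" "y \<in> M1.circ S (hd xs)" "y \<in> M2.circ S x"
  shows "is_path i (x # xs) (y # ys)"
proof -
  have len: "length xs = Suc (length ys)" using path unfolding is_path_def by blast
  then have hd: "hd xs = xs ! 0" by (cases xs) auto
  have "(x # xs) ! l \<in> reach (layers (i + l)) \<and> (\<forall>h<i + l. (x # xs) ! l \<notin> reach (layers h))"
    if "l < length (x # xs)" for l
    using assms that unfolding is_path_def by (cases l) simp_all
  moreover have "(y # ys) ! l \<in> layers (Suc (i + l)) - layers (i + l) \<and>
        (y # ys) ! l \<in> M1.circ S ((x # xs) ! Suc l) \<and> (y # ys) ! l \<in> M2.circ S ((x # xs) ! l)"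
    if "l < length (y # ys)" for l
    using assms that hd unfolding is_path_def by (cases l) (simp_all del: layers.simps)
  moreover have "(x # xs) ! length (y # ys) \<in> F" "\<forall>h<i + length (y # ys). reach (layers h) \<inter> F = {}"
    using path unfolding is_path_def by simp_all
  ultimately show ?thesis using len unfolding is_path_def by (simp del: layers.simps)
qed

text \<open>In the first matroid the circuit of \<open>xs ! Suc l\<close> avoids
  \<open>layers l\<close>, hence all earlier \<open>ys\<close>. In the second one the circuit of
  \<open>xs ! l\<close> lies in \<open>layers (Suc l)\<close>, hence avoids all later ones. This
  triangularity replaces the usual argument by unique perfect matchings.\<close>

lemma augment_path:
  assumes "is_path 0 xs ys"
  shows "S - set ys \<union> set xs \<in> I\<^sub>1" "S - set ys \<union> set xs \<in> I\<^sub>2"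
    "card (S - set ys \<union> set xs) = Suc (card S)"
proof -
  define n where "n = length ys"
  have len: "length xs = Suc n"
    and x: "\<And>l. l \<le> n \<Longrightarrow> xs ! l \<in> reach (layers l)"
    and x_new: "\<And>l h. l \<le> n \<Longrightarrow> h < l \<Longrightarrow> xs ! l \<notin> reach (layers h)"
    and xF: "xs ! n \<in> F"
    and y: "\<And>l. l < n \<Longrightarrow> ys ! l \<in> layers (Suc l)" "\<And>l. l < n \<Longrightarrow> ys ! l \<notin> layers l"
    and y1: "\<And>l. l < n \<Longrightarrow> ys ! l \<in> M1.circ S (xs ! Suc l)"
    and y2: "\<And>l. l < n \<Longrightarrow> ys ! l \<in> M2.circ S (xs ! l)"
    and noF: "\<And>h. h < n \<Longrightarrow> reach (layers h) \<inter> F = {}"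
    using assms unfolding is_path_def n_def by (simp_all del: layers.simps add: less_Suc_eq_le)
  have xV: "xs ! l \<in> V - S" if "l \<le> n" for l using x[OF that] by (auto simp: reach_def)
  have yS: "ys ! l \<in> S" if "l < n" for l using y(1)[OF that] layers_subset by blast
  have x_neq: "xs ! l \<noteq> xs ! h" if "h < l" "l \<le> n" for h l
    using x_new[OF that(2,1)] x[of h] that by auto
  have y_neq: "ys ! l \<noteq> ys ! h" if "h < l" "l < n" for h l
    using y(1)[of h] y(2)[of l] layers_mono[of "Suc h" l] that by auto
  have inj_x: "inj_on (\<lambda>l. xs ! l) {..n}" using x_neq by (intro linorder_inj_onI') (metis atMost_iff)
  have inj_y: "inj_on (\<lambda>l. ys ! l) {..<n}" using y_neq by (intro linorder_inj_onI') (metis lessThan_iff)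
  have set_ys: "set ys = (\<lambda>l. ys ! l) ` {..<n}"
    unfolding n_def set_conv_nth by auto
  have set_xs: "set xs = (\<lambda>l. xs ! l) ` {..n}"
    unfolding set_conv_nth len by (auto simp: less_Suc_eq_le)

  have "set ys \<subseteq> S" using yS set_ys by auto
  have disj: "set xs \<inter> S = {}" using xV set_xs by auto
  have card_xs: "card (set xs) = Suc n" unfolding set_xs using card_image[OF inj_x] by simp
  have card_ys: "card (set ys) = n" unfolding set_ys using card_image[OF inj_y] by simp
  have nS: "n \<le> card S" using card_mono[OF finS \<open>set ys \<subseteq> S\<close>] card_ys by simp
  have "card (S - set ys \<union> set xs) = card (S - set ys) + card (set xs)"
    using finS disj by (intro card_Un_disjoint) auto
  also have "card (S - set ys) = card S - n" using card_Diff_subset[OF _ \<open>set ys \<subseteq> S\<close>] card_ys by simp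
  finally show "card (S - set ys \<union> set xs) = Suc (card S)"
    using card_xs nS by simp

  have swap1: "S - (\<lambda>l. ys ! l) ` {..<n} \<union> (\<lambda>l. xs ! Suc l) ` {..<n} \<in> I\<^sub>1 \<and>
      S - (\<lambda>l. ys ! l) ` {..<n} \<union> (\<lambda>l. xs ! Suc l) ` {..<n} \<subseteq> M1.cl S"
  proof (rule M1.swaps_indep[OF S1 _ inj_y])
    show "inj_on (\<lambda>l. xs ! Suc l) {..<n}"
    proof (rule inj_onI)
      fix a b assume "a \<in> {..<n}" "b \<in> {..<n}" "xs ! Suc a = xs ! Suc b"
      then show "a = b" using inj_onD[OF inj_x, of "Suc a" "Suc b"] by simp
    qed
    show "xs ! Suc l \<notin> M1.cl (S - {ys ! l})" if "l < n" for l
      using y1[OF that] by (auto simp: M1.circ_def)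
    show "xs ! Suc l \<in> M1.cl (S - (\<lambda>l. ys ! l) ` {..<l})" if "l < n" for l
    proof -
      have "xs ! Suc l \<in> M1.cl (S - layers l)"
        using in_cl1_iff[OF xV] x_new[of "Suc l" l] that by simp
      moreover have "ys ! h \<in> layers l" if "h < l" for h
        using y(1)[of h] layers_mono[of "Suc h" l] that \<open>l < n\<close> by auto
      then have "S - layers l \<subseteq> S - (\<lambda>l. ys ! l) ` {..<l}" by auto
      ultimately show ?thesis by (rule M1.cl_mono')
    qed
  qed (use yS xV in auto)
  \<comment> \<open>The swaps stay inside \<open>cl S\<close>, so a source, which lies outside,
    still extends the swapped set. The last vertex has this role in the second matroid.\<close>
  have "xs ! 0 \<notin> M1.cl S" using x[of 0] in_cl1_iff[OF xV, of 0 "{}"] by simp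
  then have "xs ! 0 \<notin> M1.cl (S - (\<lambda>l. ys ! l) ` {..<n} \<union> (\<lambda>l. xs ! Suc l) ` {..<n})"
    using M1.cl_trans[of _ S] swap1 by blast
  then have "insert (xs ! 0) (S - (\<lambda>l. ys ! l) ` {..<n} \<union> (\<lambda>l. xs ! Suc l) ` {..<n}) \<in> I\<^sub>1"
    using swap1 xV[of 0] by (intro M1.insert_indep) auto
  moreover have "insert (xs ! 0) ((\<lambda>l. xs ! Suc l) ` {..<n}) = set xs"
    unfolding set_xs atMost_Suc_eq_insert_0 lessThan_Suc_atMost[symmetric] lessThan_Suc_eq_insert_0 by auto
  ultimately show "S - set ys \<union> set xs \<in> I\<^sub>1" unfolding set_ys by (metis Un_insert_right)

  \<comment> \<open>In the second matroid the swaps run from the end of the path to its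
    start.\<close>
  let ?r = "\<lambda>l. n - 1 - l"
  have rev: "(\<lambda>l. f (?r l)) ` {..<n} = f ` {..<n}" for f :: "nat \<Rightarrow> 'a"
  proof -
    have "l \<in> ?r ` {..<n}" if "l < n" for l using that by (intro image_eqI[of _ _ "?r l"]) auto
    then have "?r ` {..<n} = {..<n}" by auto
    then show ?thesis by (metis image_image)
  qed
  have inj_rev: "inj_on (\<lambda>l. f (?r l)) {..<n}" if "inj_on f {..<n}" for f :: "nat \<Rightarrow> 'a"
  proof (rule inj_onI)
    fix a b assume ab: "a \<in> {..<n}" "b \<in> {..<n}" "f (?r a) = f (?r b)"
    then have "?r a = ?r b" using inj_onD[OF that, of "?r a" "?r b"] by auto
    then show "a = b" using ab by auto
  qed
  have "S - (\<lambda>l. ys ! ?r l) ` {..<n} \<union> (\<lambda>l. xs ! ?r l) ` {..<n} \<in> I\<^sub>2 \<and>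
      S - (\<lambda>l. ys ! ?r l) ` {..<n} \<union> (\<lambda>l. xs ! ?r l) ` {..<n} \<subseteq> M2.cl S"
  proof (rule M2.swaps_indep[OF S2 _ inj_rev[OF inj_y]])
    show "inj_on (\<lambda>l. xs ! ?r l) {..<n}" by (rule inj_rev, rule inj_on_subset[OF inj_x]) auto
    show "xs ! ?r l \<notin> M2.cl (S - {ys ! ?r l})" if "l < n" for l
      using y2[of "?r l"] that by (auto simp: M2.circ_def)
    show "xs ! ?r l \<in> M2.cl (S - (\<lambda>l. ys ! ?r l) ` {..<l})" if "l < n" for l
    proof -
      have m: "?r l < n" using that by simp
      have "xs ! ?r l \<notin> F" using noF[OF m] x[of "?r l"] m by auto
      then have "xs ! ?r l \<in> M2.cl S" using in_cl2_iff[OF xV] m by simp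
      moreover have "ys ! ?r h \<notin> layers (Suc (?r l))" if "h < l" for h
      proof -
        have "Suc (?r l) \<le> ?r h" "?r h < n" using that \<open>l < n\<close> by auto
        then show ?thesis using y(2) layers_mono by blast
      qed
      then have "M2.circ S (xs ! ?r l) \<subseteq> S - (\<lambda>l. ys ! ?r l) ` {..<l}"
        using circ2_subset_layers[OF x[of "?r l"]] layers_subset[of "Suc (?r l)"] m
        by (auto simp del: layers.simps)
      ultimately show ?thesis by (subst M2.in_cl_iff_circ_subset[OF S2]) auto
    qed
  qed (use yS xV in auto)
  then have swap2: "S - (\<lambda>l. ys ! l) ` {..<n} \<union> (\<lambda>l. xs ! l) ` {..<n} \<in> I\<^sub>2"
    "S - (\<lambda>l. ys ! l) ` {..<n} \<union> (\<lambda>l. xs ! l) ` {..<n} \<subseteq> M2.cl S"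
    unfolding rev[of "\<lambda>l. xs ! l"] rev[of "\<lambda>l. ys ! l"] by auto
  have "xs ! n \<notin> M2.cl S" using xF in_cl2_iff[OF xV] by simp
  then have "xs ! n \<notin> M2.cl (S - (\<lambda>l. ys ! l) ` {..<n} \<union> (\<lambda>l. xs ! l) ` {..<n})"
    using M2.cl_trans[OF swap2(2)] by blast
  then have "insert (xs ! n) (S - (\<lambda>l. ys ! l) ` {..<n} \<union> (\<lambda>l. xs ! l) ` {..<n}) \<in> I\<^sub>2"
    using swap2 xV[of n] by (intro M2.insert_indep) auto
  moreover have "insert (xs ! n) ((\<lambda>l. xs ! l) ` {..<n}) = set xs"
    unfolding set_xs lessThan_Suc_atMost[symmetric] lessThan_Suc by auto
  ultimately show "S - set ys \<union> set xs \<in> I\<^sub>2" unfolding set_ys by (metis Un_insert_right)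
qed

end

section \<open>Query cost of one search\<close>

context common_indep
begin

text \<open>With \<open>D\<close> removed from \<open>S\<close>, the element \<open>x\<close> can be
  added exactly when \<open>D\<close> meets its circuit, so one query tells which half of the list
  to keep.\<close>

lemma wp_bsearch:
  assumes x: "x \<in> V - S" "x \<in> M2.cl S"
    and L: "set L \<subseteq> S" "length L \<le> 2 ^ j" "set L \<inter> M2.circ S x \<noteq> {}"
    and Q: "\<And>y c'. y \<in> set L \<Longrightarrow> y \<in> M2.circ S x \<Longrightarrow> c' \<le> c + j \<Longrightarrow> Q y c'"
  shows "wp V query (bsearch S x j L) c Q"
  using L Q
proof (induction j arbitrary: L c)
  case 0
  then have "length L = 1" by (cases L) auto
  then obtain y where "L = [y]" by (cases L) auto
  then show ?case using 0 by simp
next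
  case (Suc j)
  let ?L1 = "take (2 ^ j) L" and ?L2 = "drop (2 ^ j) L"
  have split: "set L = set ?L1 \<union> set ?L2" by (metis append_take_drop_id set_append)
  have "query False (insert x (S - set ?L1)) \<longleftrightarrow> x \<notin> M2.cl (S - set ?L1)"
    using M2.insert_indep_iff[of "S - set ?L1" x] M2.indep_subset[OF S2, of "S - set ?L1"] x by auto
  also have "\<dots> \<longleftrightarrow> \<not> M2.circ S x \<subseteq> S - set ?L1"
    using M2.in_cl_iff_circ_subset[OF S2 x(2)] by auto
  also have "\<dots> \<longleftrightarrow> set ?L1 \<inter> M2.circ S x \<noteq> {}" using M2.circ_subset by auto
  finally have eq: "query False (insert x (S - set ?L1)) \<longleftrightarrow> set ?L1 \<inter> M2.circ S x \<noteq> {}" .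
  have sub: "insert x (S - set ?L1) \<subseteq> V" using x SV by auto
  show ?case
  proof (cases "set ?L1 \<inter> M2.circ S x \<noteq> {}")
    case True
    then have "wp V query (bsearch S x j ?L1) (c + 1) Q"
      using Suc.prems split by (intro Suc.IH) auto
    then show ?thesis using eq True sub by simp
  next
    case False
    then have "wp V query (bsearch S x j ?L2) (c + 1) Q"
      using Suc.prems split by (intro Suc.IH) auto
    then show ?thesis using eq False sub by simp
  qed
qed

text \<open>Dropping a list element costs one query, a new element of \<open>S\<close> costs one
  plus \<open>j\<close> for the search. The charge for \<open>B\<close> stands on the left so that
  consecutive layers add up to \<open>(j + 1) * card S\<close> without subtraction.\<close>

lemma wp_expand:
  assumes j: "card S \<le> 2 ^ j"
    and "set xs \<subseteq> V - S" "set xs \<inter> F = {}" "B \<subseteq> S" "length xs + card (S - B) \<le> f"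
    and Q: "\<And>c'. c' + (j + 1) * card B \<le> c + length xs + (j + 1) * card (B \<union> (\<Union>x\<in>set xs. M2.circ S x)) \<Longrightarrow>
        Q (B \<union> (\<Union>x\<in>set xs. M2.circ S x)) c'"
  shows "wp V query (expand S j f xs B) c Q"
  using assms(2-)
proof (induction f arbitrary: xs B c)
  case 0 then show ?case by simp
next
  case (Suc f)
  show ?case
  proof (cases xs)
    case Nil then show ?thesis using Suc.prems by simp
  next
    case (Cons x xs')
    have x: "x \<in> V - S" "x \<in> M2.cl S" using Suc.prems in_cl2_iff[of x] Cons by auto
    have sub: "insert x B \<subseteq> V" using x Suc.prems SV by auto
    have "B \<in> I\<^sub>2" using M2.indep_subset[OF S2 Suc.prems(3)] .
    then have "insert x B \<in> I\<^sub>2 \<longleftrightarrow> x \<notin> M2.cl B"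
      using M2.insert_indep_iff[of B x] x Suc.prems(3) by auto
    then have eq: "insert x B \<in> I\<^sub>2 \<longleftrightarrow> \<not> M2.circ S x \<subseteq> B"
      using M2.in_cl_iff_circ_subset[OF S2 x(2) Suc.prems(3)] by simp
    show ?thesis
    proof (cases "M2.circ S x \<subseteq> B")
      case True
      then have U: "B \<union> (\<Union>x\<in>set xs. M2.circ S x) = B \<union> (\<Union>x\<in>set xs'. M2.circ S x)" using Cons by auto
      have "wp V query (expand S j f xs' B) (c + 1) Q"
      proof (rule Suc.IH)
        show "Q (B \<union> (\<Union>x\<in>set xs'. M2.circ S x)) c'"
          if "c' + (j + 1) * card B \<le> c + 1 + length xs' + (j + 1) * card (B \<union> (\<Union>x\<in>set xs'. M2.circ S x))" for c'
          using Suc.prems(5)[of c'] that unfolding U by (simp add: Cons)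
      qed (use Suc.prems Cons in auto)
      then show ?thesis using eq True sub Cons by simp
    next
      case False
      have fin: "finite (S - B)" using finS by simp
      note l = list_by[OF fin, of "\<lambda>_. 0"]
      have "card (S - B) \<le> 2 ^ j" using card_mono[OF finS, of "S - B"] j by auto
      moreover have "set (list_by (\<lambda>_. 0) (S - B)) \<inter> M2.circ S x \<noteq> {}"
        unfolding l(1) using False M2.circ_subset[of S x] by auto
      ultimately have "wp V query (bind (bsearch S x j (list_by (\<lambda>_. 0) (S - B))) (\<lambda>y. expand S j f xs (insert y B))) (c + 1) Q"
        unfolding wp_bind
      proof (intro wp_bsearch[OF x])
        fix y c' assume "y \<in> set (list_by (\<lambda>_. 0) (S - B))" and yC: "y \<in> M2.circ S x" and c': "c' \<le> c + 1 + j"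
        then have y: "y \<in> S" "y \<notin> B" using l(1) by auto
        have U: "insert y B \<union> (\<Union>x\<in>set xs. M2.circ S x) = B \<union> (\<Union>x\<in>set xs. M2.circ S x)"
          using yC Cons by auto
        have cB: "card (insert y B) = Suc (card B)"
          using y finite_subset[OF Suc.prems(3) finS] by simp
        have "card (S - B) = Suc (card (S - insert y B))"
          using card_Suc_Diff1[OF fin, of y] y by (simp add: Diff_insert2[symmetric])
        then show "wp V query (expand S j f xs (insert y B)) c' Q"
        proof (intro Suc.IH)
          show "Q (insert y B \<union> (\<Union>x\<in>set xs. M2.circ S x)) c''"
            if "c'' + (j + 1) * card (insert y B) \<le> c' + length xs + (j + 1) * card (insert y B \<union> (\<Union>x\<in>set xs. M2.circ S x))"
            for c''
            using that c' Suc.prems(5)[of c''] unfolding U cB by simp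
        qed (use Suc.prems y in auto)
      qed (use l in auto)
      then show ?thesis using eq False sub Cons by simp
    qed
  qed
qed

lemma reach_eq: "{x \<in> set (list_by (\<lambda>_. 0) (V - S)). query True (insert x (S - B)) \<and> query False {}} = reach B"
  using list_by(1)[of "V - S" "\<lambda>_. 0"] M1.finite_V by (simp add: reach_def)

text \<open>The factor \<open>7\<close> per layer is made up of three scans with two queries per
  element and one failed test per element in \<open>expand\<close>. Every further layer adds an
  element of \<open>S\<close>, so the fuel suffices.\<close>

lemma wp_augment:
  assumes j: "card S \<le> 2 ^ j"
    and "B = layers i" "card (S - B) < f" "\<forall>h<i. reach (layers h) \<inter> F = {}"
    and "\<And>xs ys c'. is_path i xs ys \<Longrightarrow>
        c' + (j + 1) * card B \<le> c + Suc (length ys) * (7 * card V) + (j + 1) * card S \<Longrightarrow> Q (Some (xs, ys)) c'"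
    and "\<And>c'. (\<And>J. J \<in> I\<^sub>1 \<Longrightarrow> J \<in> I\<^sub>2 \<Longrightarrow> card J \<le> card S) \<Longrightarrow>
        c' + (j + 1) * card B \<le> c + f * (7 * card V) + (j + 1) * card S \<Longrightarrow> Q None c'"
  shows "wp V query (augment V j S F f B) c Q"
  using assms(2-)
proof (induction f arbitrary: i B c Q)
  case 0 then show ?case by simp
next
  case (Suc f)
  let ?n = "card V"
  define A where "A = reach B"
  have fin: "finite (V - S)" "finite A" using M1.finite_V by (auto simp: A_def reach_def)
  have AV: "A \<subseteq> V - S" by (auto simp: A_def reach_def)
  have BS: "B \<subseteq> S" using Suc.prems(1) layers_subset by simp
  have cards: "card (V - S) \<le> ?n" "card A \<le> ?n" "card S \<le> ?n"
    using AV SV by (auto intro!: card_mono M1.finite_V)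
  have cB: "card B \<le> card S" by (rule card_mono[OF finS BS])
  note lA = list_by[OF fin(2), of "\<lambda>_. 0"] and lV = list_by[OF fin(1), of "\<lambda>_. 0"]
  show ?case
    unfolding augment.simps(2)
  proof (rule wp_scan_bind[where R = A and l = ?n])
    show "select (\<lambda>_ x. query True (insert x (S - B)) \<and> query False {}) (list_by (\<lambda>_. 0) (V - S)) {} = A"
      unfolding select_filter reach_eq A_def by simp
  next
    fix c1 assume c1: "c1 \<le> c + 2 * ?n"
    let ?rest = "\<lambda>B' res. case res of None \<Rightarrow> Return None | Some (xs, ys) \<Rightarrow>
       bind (scan (\<lambda>_ y. insert (hd xs) (S - {y})) (\<lambda>_ _. {}) (list_by (\<lambda>_. 0) (B' - B)) {}) (\<lambda>Y.
       bind (scan (\<lambda>_ _. {}) (\<lambda>_ x. insert x (S - {SOME y. y \<in> Y})) (list_by (\<lambda>_. 0) A) {}) (\<lambda>X.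
       Return (Some ((SOME x. x \<in> X) # xs, (SOME y. y \<in> Y) # ys))))"
    show "wp V query (if A \<inter> F \<noteq> {} then Return (Some ([SOME x. x \<in> A \<inter> F], [])) else
      bind (expand S j (card V + card S) (list_by (\<lambda>_. 0) A) B) (\<lambda>B'.
      if B' = B then Return None else bind (augment V j S F f B') (?rest B'))) c1 Q"
    proof (cases "A \<inter> F = {}")
      case False
      then have x: "(SOME x. x \<in> A \<inter> F) \<in> A \<inter> F" by (metis someI_ex ex_in_conv)
      then have "is_path i [SOME x. x \<in> A \<inter> F] []"
        using Suc.prems(1,3) unfolding is_path_def A_def by auto
      moreover have "(j + 1) * card B \<le> (j + 1) * card S" using cB by (rule mult_le_mono2)
      ultimately have "Q (Some ([SOME x. x \<in> A \<inter> F], [])) c1"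
        using c1 by (intro Suc.prems(4)) auto
      then show ?thesis using False by simp
    next
      case noF: True
      define B' where "B' = layers (Suc i)"
      have B'_eq: "B' = B \<union> (\<Union>x\<in>A. M2.circ S x)" by (simp add: B'_def A_def Suc.prems(1))
      have "B' \<subseteq> S" unfolding B'_def by (rule layers_subset)
      have noF': "\<forall>h<Suc i. reach (layers h) \<inter> F = {}"
        using Suc.prems(1,3) noF by (auto simp: A_def less_Suc_eq)
      have "wp V query (bind (expand S j (card V + card S) (list_by (\<lambda>_. 0) A) B) (\<lambda>B'.
        if B' = B then Return None else bind (augment V j S F f B') (?rest B'))) c1 Q"
        unfolding wp_bind[of _ _ "expand _ _ _ _ _"]
      proof (rule wp_expand[OF j])
        fix c2 assume "c2 + (j + 1) * card B \<le> c1 + length (list_by (\<lambda>_. 0) A) +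
          (j + 1) * card (B \<union> (\<Union>x\<in>set (list_by (\<lambda>_. 0) A). M2.circ S x))"
        then have c2: "c2 + (j + 1) * card B \<le> c + 3 * ?n + (j + 1) * card B'"
          using lA cards c1 unfolding B'_eq by simp
        have "wp V query (if B' = B then Return None else bind (augment V j S F f B') (?rest B')) c2 Q"
        proof (cases "B' = B")
          case True
          have "Q None c2"
          proof (rule Suc.prems(5))
            show "card J \<le> card S" if "J \<in> I\<^sub>1" "J \<in> I\<^sub>2" for J
              using maximum_if_stuck[OF that, of i] noF' True unfolding B'_def Suc.prems(1) by simp
            show "c2 + (j + 1) * card B \<le> c + Suc f * (7 * ?n) + (j + 1) * card S"
              using c2 True mult_le_mono2[OF cB, of "j + 1"] by simp
          qed
          then show ?thesis using True by simp
        next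
          case False
          have "B \<subseteq> B'" unfolding B'_eq by auto
          then have "card (S - B') < card (S - B)"
            using False \<open>B' \<subseteq> S\<close> finS by (intro psubset_card_mono) auto
          then have f: "card (S - B') < f" using Suc.prems(2) by simp
          have finB': "finite (B' - B)" using \<open>B' \<subseteq> S\<close> finS finite_subset by blast
          note lB = list_by[OF finB', of "\<lambda>_. 0"]
          have cB': "card (B' - B) \<le> ?n" using \<open>B' \<subseteq> S\<close> SV by (intro card_mono M1.finite_V) auto
          have "wp V query (bind (augment V j S F f B') (?rest B')) c2 Q"
            unfolding wp_bind[of _ _ "augment _ _ _ _ _ _"]
          proof (rule Suc.IH[OF B'_def f noF'])
            fix c3 assume "c3 + (j + 1) * card B' \<le> c2 + f * (7 * ?n) + (j + 1) * card S"
              and "\<And>J. J \<in> I\<^sub>1 \<Longrightarrow> J \<in> I\<^sub>2 \<Longrightarrow> card J \<le> card S"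
            then show "wp V query (?rest B' None) c3 Q"
              using c2 by (simp add: Suc.prems(5))
          next
            fix xs ys c3
            assume path: "is_path (Suc i) xs ys"
              and c3: "c3 + (j + 1) * card B' \<le> c2 + Suc (length ys) * (7 * ?n) + (j + 1) * card S"
            have len: "length xs = Suc (length ys)" and hd: "hd xs = xs ! 0"
              using path unfolding is_path_def by (auto simp: hd_conv_nth simp flip: length_greater_0_conv)
            have z: "hd xs \<in> reach B'" "hd xs \<notin> reach B"
              using path len unfolding is_path_def hd B'_def Suc.prems(1) by (auto simp del: layers.simps)
            have zV: "hd xs \<in> V - S" using z(1) by (auto simp: reach_def)
            define Y where "Y = {y \<in> B' - B. insert (hd xs) (S - {y}) \<in> I\<^sub>1}"
            define y where "y = (SOME y. y \<in> Y)"
            have Y_iff: "y \<in> Y \<longleftrightarrow> y \<in> B' - B \<and> y \<in> M1.circ S (hd xs)" for y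
              using M1.in_circ_iff[OF S1 _ zV] \<open>B' \<subseteq> S\<close> unfolding Y_def by auto
            have "hd xs \<in> M1.cl S"
              using in_cl1_iff[OF zV, of B] z(2) M1.cl_mono[of "S - B" S] by auto
            \<comment> \<open>\<open>hd xs\<close> is reached from \<open>B'\<close> but not from
              \<open>B\<close>, so its circuit meets \<open>B'\<close> and avoids \<open>B\<close>:
              the link is a new element.\<close>
            then have "M1.circ S (hd xs) \<subseteq> S - B" "\<not> M1.circ S (hd xs) \<subseteq> S - B'"
              using M1.in_cl_iff_circ_subset[OF S1, of "hd xs" "S - _"] in_cl1_iff[OF zV] z by auto
            then have "Y \<noteq> {}" using Y_iff by blast
            then have yY: "y \<in> Y" unfolding y_def by (metis someI_ex ex_in_conv)
            then have y: "y \<in> B'" "y \<notin> B" "y \<in> M1.circ S (hd xs)" using Y_iff by auto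
            have "y \<in> S" using y(1) \<open>B' \<subseteq> S\<close> by auto
            define X where "X = {x \<in> A. insert x (S - {y}) \<in> I\<^sub>2}"
            define x where "x = (SOME x. x \<in> X)"
            have X_iff: "x \<in> X \<longleftrightarrow> x \<in> A \<and> y \<in> M2.circ S x" for x
              using M2.in_circ_iff[OF S2 \<open>y \<in> S\<close>] AV unfolding X_def by auto
            have "X \<noteq> {}" using y X_iff unfolding B'_eq by auto
            then have "x \<in> X" unfolding x_def by (metis someI_ex ex_in_conv)
            then have x: "x \<in> A" "y \<in> M2.circ S x" using X_iff by auto
            \<comment> \<open>Had \<open>x\<close> been reached earlier, \<open>y\<close> would
              belong to an earlier layer.\<close>
            have x_new: "x \<notin> reach (layers h)" if "h < i" for h
            proof
              assume "x \<in> reach (layers h)"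
              then have "y \<in> layers (Suc h)" using x(2) by auto
              then show False using layers_mono[of "Suc h" i] that y(2) Suc.prems(1) by auto
            qed
            have path': "is_path i (x # xs) (y # ys)"
            proof (rule is_path_Cons[OF path _ _ _ y(3) x(2)])
              show "x \<in> reach (layers i)" using x(1) by (simp add: A_def Suc.prems(1))
              show "\<forall>h<i. x \<notin> reach (layers h)" using x_new by simp
              show "y \<in> layers (Suc i) - layers i" using y(1,2) unfolding B'_def Suc.prems(1) by simp
            qed
            have "wp V query (bind (scan (\<lambda>_ y. insert (hd xs) (S - {y})) (\<lambda>_ _. {}) (list_by (\<lambda>_. 0) (B' - B)) {}) (\<lambda>Y.
               bind (scan (\<lambda>_ _. {}) (\<lambda>_ x. insert x (S - {SOME y. y \<in> Y})) (list_by (\<lambda>_. 0) A) {}) (\<lambda>X.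
               Return (Some ((SOME x. x \<in> X) # xs, (SOME y. y \<in> Y) # ys))))) c3 Q"
            proof (rule wp_scan_bind[where R = Y and l = ?n])
              show "select (\<lambda>_ y. query True (insert (hd xs) (S - {y})) \<and> query False {}) (list_by (\<lambda>_. 0) (B' - B)) {} = Y"
                unfolding select_filter lB(1) by (simp add: Y_def)
            next
              fix c4 assume c4: "c4 \<le> c3 + 2 * ?n"
              show "wp V query (bind (scan (\<lambda>_ _. {}) (\<lambda>_ x. insert x (S - {SOME y. y \<in> Y})) (list_by (\<lambda>_. 0) A) {}) (\<lambda>X.
                 Return (Some ((SOME x. x \<in> X) # xs, (SOME y. y \<in> Y) # ys)))) c4 Q"
                unfolding y_def[symmetric]
              proof (rule wp_scan_bind[where R = X and l = ?n])
                show "select (\<lambda>_ x. query True {} \<and> query False (insert x (S - {y}))) (list_by (\<lambda>_. 0) A) {} = X"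
                  unfolding select_filter lA(1) by (simp add: X_def)
              next
                fix c5 assume c5: "c5 \<le> c4 + 2 * ?n"
                have "Q (Some (x # xs, y # ys)) c5"
                  by (rule Suc.prems(4)[OF path']) (use c2 c3 c4 c5 in simp)
                then show "wp V query (Return (Some ((SOME x. x \<in> X) # xs, y # ys))) c5 Q"
                  by (simp add: x_def)
              qed (use lA cards AV SV in auto)
            qed (use lB cB' zV SV \<open>B' \<subseteq> S\<close> in auto)
            then show "wp V query (?rest B' (Some (xs, ys))) c3 Q" by simp
          qed
          then show ?thesis using False by simp
        qed
        then show "wp V query (if B \<union> (\<Union>x\<in>set (list_by (\<lambda>_. 0) A). M2.circ S x) = B then Return None
          else bind (augment V j S F f (B \<union> (\<Union>x\<in>set (list_by (\<lambda>_. 0) A). M2.circ S x)))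
            (?rest (B \<union> (\<Union>x\<in>set (list_by (\<lambda>_. 0) A). M2.circ S x)))) c2 Q"
          unfolding lA(1) B'_eq .
      next
        show "length (list_by (\<lambda>_. 0) A) + card (S - B) \<le> card V + card S"
          using lA cards card_mono[OF finS, of "S - B"] by simp
      qed (use lA AV noF BS in auto)
      then show ?thesis using noF by simp
    qed
  qed (use lV cards SV in auto)
qed

end

section \<open>Total cost of the exact algorithm\<close>

definition path_cost :: "nat \<Rightarrow> nat \<Rightarrow> nat \<Rightarrow> nat \<Rightarrow> nat" where
  "path_cost n j r d = (\<Sum>i=1..d. n * (10 + j + 7 * (r div i))) + n * (10 + j + 7 * r)"

context two_matroids
begin

text \<open>In \<open>path_cost\<close> the index \<open>i\<close> is the number of missing
  elements, and a path has at most \<open>r div i\<close> vertices in \<open>S\<close>. Of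
  \<open>10 + j\<close>, \<open>2\<close> pays for the scan for \<open>F\<close>, \<open>7\<close>
  for the last layer and \<open>j + 1\<close> for the binary searches. The separate last term is the
  failed search that certifies optimality.\<close>

lemma wp_intersect:
  assumes J: "J \<in> I\<^sub>1" "J \<in> I\<^sub>2" and max: "\<And>A. A \<in> I\<^sub>1 \<Longrightarrow> A \<in> I\<^sub>2 \<Longrightarrow> card A \<le> card J"
    and j: "card J \<le> 2 ^ j"
    and "S \<in> I\<^sub>1" "S \<in> I\<^sub>2" "card J - card S < f"
    and "\<And>S' c'. S' \<in> I\<^sub>1 \<Longrightarrow> S' \<in> I\<^sub>2 \<Longrightarrow> card S' = card J \<Longrightarrow>
       c' \<le> c + path_cost (card V) j (card J) (card J - card S) \<Longrightarrow> Q S' c'"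
  shows "wp V query (intersect V j f S) c Q"
  using assms(5-)
proof (induction f arbitrary: S c)
  case 0 then show ?case by simp
next
  case (Suc f)
  interpret common_indep V I\<^sub>1 I\<^sub>2 S using Suc.prems by unfold_locales
  let ?n = "card V"
  have fin: "finite (V - S)" using M1.finite_V by simp
  note l = list_by[OF fin, of "\<lambda>_. 0"]
  have cS: "card S \<le> card J" by (rule max[OF S1 S2])
  have Sn: "card S \<le> ?n" by (rule card_mono[OF M1.finite_V SV])
  have jS: "(j + 1) * card S \<le> ?n * (j + 1)" using Sn by (metis mult.commute mult_le_mono1)
  show ?case
    unfolding intersect.simps(2)
  proof (rule wp_scan_bind[where R = F and l = ?n])
    show "select (\<lambda>_ x. query True {} \<and> query False (insert x S)) (list_by (\<lambda>_. 0) (V - S)) {} = F"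
      unfolding select_filter l(1) by (simp add: F_def)
  next
    fix c1 assume c1: "c1 \<le> c + 2 * ?n"
    show "wp V query (bind (augment V j S F (Suc (card S)) {}) (\<lambda>res. case res of None \<Rightarrow> Return S
       | Some (xs, ys) \<Rightarrow> intersect V j f (S - set ys \<union> set xs))) c1 Q"
      unfolding wp_bind
    proof (rule wp_augment[where i = 0])
      show "card S \<le> 2 ^ j" using cS j by simp
    next
      fix c2 assume opt: "\<And>J. J \<in> I\<^sub>1 \<Longrightarrow> J \<in> I\<^sub>2 \<Longrightarrow> card J \<le> card S"
        and c2: "c2 + (j + 1) * card {} \<le> c1 + Suc (card S) * (7 * ?n) + (j + 1) * card S"
      have eq: "card S = card J" using opt[OF J] cS by simp
      have "c2 \<le> c + ?n * (10 + j + 7 * card J)"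
        using c1 c2 jS unfolding eq by (simp add: algebra_simps)
      then have "Q S c2"
        by (intro Suc.prems(4)[OF S1 S2 eq]) (simp add: path_cost_def)
      then show "wp V query (case None of None \<Rightarrow> Return S
         | Some (xs, ys) \<Rightarrow> intersect V j f (S - set ys \<union> set xs)) c2 Q" by simp
    next
      fix xs ys c2 assume path: "is_path 0 xs ys"
        and c2: "c2 + (j + 1) * card {} \<le> c1 + Suc (length ys) * (7 * ?n) + (j + 1) * card S"
      let ?S = "S - set ys \<union> set xs" and ?d = "card J - card S"
      note S' = augment_path[OF path]
      have "card ?S \<le> card J" by (rule max[OF S'(1,2)])
      then have d: "?d = Suc (card J - card ?S)" using S'(3) by simp
      have "length ys * card J \<le> length ys * card S + card S"
        by (rule path_length_bound[OF J]) (use path in \<open>simp add: is_path_def\<close>)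
      then have "length ys * ?d \<le> card J" using cS by (simp add: diff_mult_distrib2)
      then have "length ys \<le> card J div ?d" using d by (simp add: less_eq_div_iff_mult_less_eq)
      then have "?n * length ys \<le> ?n * (card J div ?d)" by (rule mult_le_mono2)
      moreover have "c2 \<le> c1 + (7 * ?n + 7 * (?n * length ys)) + (?n * j + ?n)"
        using c2 jS by (simp add: algebra_simps)
      ultimately have "c2 \<le> c + (10 * ?n + ?n * j + 7 * (?n * (card J div ?d)))" using c1 by linarith
      then have "c2 \<le> c + ?n * (10 + j + 7 * (card J div ?d))" by (simp add: algebra_simps)
      then have cost: "c2 + path_cost ?n j (card J) (card J - card ?S) \<le> c + path_cost ?n j (card J) ?d"
        unfolding d path_cost_def by simp
      have "wp V query (intersect V j f ?S) c2 Q"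
        using cost d Suc.prems(3) by (intro Suc.IH[OF S'(1,2)] Suc.prems(4)) auto
      then show "wp V query (case Some (xs, ys) of None \<Rightarrow> Return S
         | Some (xs, ys) \<Rightarrow> intersect V j f (S - set ys \<union> set xs)) c2 Q" by simp
    qed auto
  qed (use l SV card_mono[OF M1.finite_V, of "V - S"] in auto)
qed

text \<open>A refused element is spanned by \<open>S\<close> in one of the matroids, so the two
  closures, each of rank \<open>card S\<close>, cover \<open>J\<close>.\<close>

lemma maximal_common_indep:
  defines "S \<equiv> select (\<lambda>A x. insert x A \<in> I\<^sub>1 \<and> insert x A \<in> I\<^sub>2) (list_by (\<lambda>_. 0) V) {}"
  shows "S \<in> I\<^sub>1" "S \<in> I\<^sub>2" "\<And>J. J \<in> I\<^sub>1 \<Longrightarrow> J \<in> I\<^sub>2 \<Longrightarrow> card J \<le> 2 * card S"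
proof -
  have "S \<in> I\<^sub>1 \<and> S \<in> I\<^sub>2" unfolding S_def by (rule select_invariant) auto
  then show S: "S \<in> I\<^sub>1" "S \<in> I\<^sub>2" by auto
  fix J assume J: "J \<in> I\<^sub>1" "J \<in> I\<^sub>2"
  have "J \<subseteq> M1.cl S \<union> M2.cl S"
  proof
    fix x assume "x \<in> J"
    then have x: "x \<in> V" using M1.indep_subset_V[OF J(1)] by auto
    show "x \<in> M1.cl S \<union> M2.cl S"
    proof (cases "x \<in> S")
      case True then show ?thesis using x M1.cl_extensive[of x S] by simp
    next
      case False
      have "x \<in> set (list_by (\<lambda>_. 0) V)" using x list_by(1)[OF M1.finite_V] by simp
      then obtain B ys zs where "list_by (\<lambda>_. 0) V = ys @ x # zs" "B \<subseteq> S" "{} \<subseteq> B" "B \<subseteq> {} \<union> set ys"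
        and n: "\<not> (insert x B \<in> I\<^sub>1 \<and> insert x B \<in> I\<^sub>2)"
        using False unfolding S_def by (rule select_rejected)
      have "B \<in> I\<^sub>1" "B \<in> I\<^sub>2" using M1.indep_subset M2.indep_subset S \<open>B \<subseteq> S\<close> by auto
      then have "x \<in> M1.cl B \<or> x \<in> M2.cl B" using n x M1.insert_indep[of B x] M2.insert_indep[of B x] by auto
      then show ?thesis using M1.cl_mono[OF \<open>B \<subseteq> S\<close>] M2.cl_mono[OF \<open>B \<subseteq> S\<close>] by auto
    qed
  qed
  then have "card J \<le> M1.rk (M1.cl S) + M2.rk (M2.cl S)" by (rule common_le_rk[OF J])
  also have "\<dots> \<le> M1.rk S + M2.rk S"
    by (intro add_mono M1.rk_le_of_subset_cl M2.rk_le_of_subset_cl order_refl)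
  finally show "card J \<le> 2 * card S" using M1.rk_indep[OF S(1)] M2.rk_indep[OF S(2)] by simp
qed

lemma auction_inv_initial: "auction_inv k {} (\<lambda>_. 0)"
  unfolding auction_inv_def M1.indep_over_def by auto

lemma potential_initial:
  assumes "\<And>J. J \<in> I\<^sub>1 \<Longrightarrow> card J \<le> m"
  shows "potential m k {} (\<lambda>_. 0) \<le> 2 * k * m"
proof -
  have "M1.rk A \<le> m" for A using assms M1.rk_witness[of A] by metis
  then have "(\<Sum>q<k. M1.rk {e \<in> V. bid {} (\<lambda>_. 0) e \<le> q}) \<le> (\<Sum>q<k. m)" by (intro sum_mono) auto
  moreover have "(\<Sum>q<k. m - M2.rk {e \<in> V. q < (0::nat)}) \<le> (\<Sum>q<k. m)" by (intro sum_mono) auto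
  moreover have "(\<Sum>q<k. m) = k * m" by simp
  ultimately show ?thesis unfolding potential_def by linarith
qed

end

lemma matroid_truncation:
  assumes "matroid V I" shows "matroid V {S \<in> I. card S \<le> m}"
proof -
  interpret fin_matroid V I using assms by unfold_locales
  show ?thesis
    unfolding matroid_def
  proof (intro conjI ballI allI impI)
    show "finite V" by (rule finite_V)
    show "{S \<in> I. card S \<le> m} \<subseteq> Pow V" using indep_subset_V by auto
    have "{} \<in> {S \<in> I. card S \<le> m}" by simp
    then show "{S \<in> I. card S \<le> m} \<noteq> {}" by blast
  next
    fix S T assume "S \<in> {S \<in> I. card S \<le> m}" "T \<subseteq> S"
    then have "T \<in> I" "card T \<le> card S" "card S \<le> m"
      using indep_subset[of S T] finite_indep[of S] card_mono[of S T] by simp_all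
    then show "T \<in> {S \<in> I. card S \<le> m}" by simp
  next
    fix S T assume ST: "S \<in> {S \<in> I. card S \<le> m}" "T \<in> {S \<in> I. card S \<le> m}" "card T < card S"
    then obtain x where x: "x \<in> S - T" "insert x T \<in> I" using indep_exchange[of S T] by auto
    moreover have "card (insert x T) \<le> Suc (card T)" by (rule card_insert_le_m1) simp_all
    ultimately have "T \<union> {x} \<in> {S \<in> I. card S \<le> m}" using ST by simp
    then show "\<exists>x\<in>S - T. T \<union> {x} \<in> {S \<in> I. card S \<le> m}" using x(1) by blast
  qed
qed

text \<open>Since the greedy common independent set has at least half the maximum size, truncating both matroids to
  twice its size loses nothing and bounds the auction's potential in terms of \<open>r\<close>.\<close>

definition solve :: "'a set \<Rightarrow> real \<Rightarrow> ('a, 'a set) prog" where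
  "solve V \<epsilon> = (if \<epsilon> \<ge> 1 then Return {} else
     bind (scan (\<lambda>A x. insert x A) (\<lambda>A x. insert x A) (list_by (\<lambda>_. 0) V) {}) (\<lambda>S.
     let s = card S; R = real (max 2 s) in
     if s = 0 then Return {}
     else if \<epsilon> * sqrt (R * ln R) \<ge> 1 then
       (let k = nat \<lceil>2 / \<epsilon>\<rceil>; d = nat \<lfloor>\<epsilon> * real s / 2\<rfloor>
        in trunc (2 * s) (auction V k d (4 * k * s div (d + 1) + 1) {} (\<lambda>_. 0)))
     else intersect V (nat \<lceil>log 2 (2 * real s)\<rceil>) (2 * s + 1) S))"

section \<open>Parameters and constants\<close>

lemma real_div_le: "real (a div b) \<le> real a / real b"
  using of_int_floor_le[of "real a / real b"] unfolding floor_divide_of_nat_eq by simp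

lemma path_cost_le:
  assumes "1 \<le> r" "d \<le> r" "1 \<le> s" "s \<le> r" "j = nat \<lceil>log 2 (2 * real s)\<rceil>"
  shows "real (path_cost n j r d) \<le> 70 * (real n * (real (max 2 r) * ln (real (max 2 r))))"
proof -
  define R where "R = real (max 2 r)"
  have ln2: "2 / 3 \<le> ln (2::real)" by (rule ln2_ge_two_thirds)
  have "2 \<le> R" "real r \<le> R" unfolding R_def by simp_all
  then have lnR: "ln 2 \<le> ln R" "ln (real r) \<le> ln R" using assms(1) by simp_all
  then have lnR3: "2 / 3 \<le> ln R" using ln2 by linarith
  have r0: "0 \<le> ln (real r)" using assms(1) by simp
  \<comment> \<open>The difference between harmonic number and logarithm decreases from its value 1
    at \<open>r = 1\<close>.\<close>
  have "harm r \<le> 1 + ln (real r)"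
  proof -
    obtain r' where r': "r = Suc r'" using assms(1) by (cases r) auto
    have "harm (Suc r') - ln (real (Suc r')) \<le> harm (Suc 0) - ln (real (Suc 0))"
      using decseq_harm_diff_ln unfolding decseq_def by blast
    then show ?thesis unfolding r' by (simp add: harm_def)
  qed
  moreover have "(\<Sum>i=1..d. real (r div i)) \<le> real r * harm r"
  proof -
    have "(\<Sum>i=1..d. real (r div i)) \<le> (\<Sum>i=1..r. real (r div i))"
      using assms(2) by (intro sum_mono2) auto
    also have "\<dots> \<le> (\<Sum>i=1..r. real r * inverse (real i))"
      by (intro sum_mono) (use real_div_le in \<open>simp add: divide_inverse\<close>)
    finally show ?thesis by (simp add: harm_def sum_distrib_left)
  qed
  ultimately have H: "(\<Sum>i=1..d. real (r div i)) \<le> real r * (1 + ln R)"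
    using lnR(2) by (meson add_left_mono mult_left_mono of_nat_0_le_iff order_trans)
  have "real j \<le> 3 + 3 / 2 * ln R"
  proof -
    have "log 2 (2 * real s) = 1 + ln (real s) / ln 2"
      using assms(3) by (simp add: log_def ln_mult add_divide_distrib)
    also have "ln (real s) / ln 2 \<le> ln R / (2 / 3)"
      using assms(3,4) lnR ln2 by (intro frac_le) (auto simp: R_def max_def)
    finally have "log 2 (2 * real s) \<le> 1 + 3 / 2 * ln R" by simp
    moreover have "0 \<le> log 2 (2 * real s)" using assms(3) by simp
    ultimately show ?thesis unfolding assms(5) by linarith
  qed
  then have j: "10 + real j \<le> 21 * ln R" using lnR3 by linarith
  have j0: "0 \<le> 10 + real j" by simp
  have "real d * (10 + real j) \<le> real r * (21 * ln R)"
    using assms(2) j j0 by (intro mult_mono) auto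
  moreover have "1 * (10 + real j) \<le> real r * (21 * ln R)"
    using assms(1) j j0 by (intro mult_mono) auto
  moreover have "real r * (1 + ln R) \<le> real r * (5 / 2 * ln R)"
    using lnR3 by (intro mult_left_mono) auto
  moreover have "real r * 1 \<le> real r * (3 / 2 * ln R)"
    using lnR3 by (intro mult_left_mono) auto
  \<comment> \<open>The four bounds contribute \<open>21\<close>, \<open>7 * 5 / 2\<close>,
    \<open>21\<close> and \<open>7 * 3 / 2\<close>, in total \<open>70\<close>.\<close>
  ultimately have "real d * (10 + real j) + 7 * (\<Sum>i=1..d. real (r div i)) + (10 + real j + 7 * real r)
      \<le> 70 * (real r * ln R)"
    using H by simp
  then have "real n * (real d * (10 + real j) + 7 * (\<Sum>i=1..d. real (r div i)) + (10 + real j + 7 * real r))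
      \<le> real n * (70 * (real r * ln R))"
    by (rule mult_left_mono) simp
  also have "real n * (real d * (10 + real j) + 7 * (\<Sum>i=1..d. real (r div i)) + (10 + real j + 7 * real r))
      = real (path_cost n j r d)"
    by (simp add: path_cost_def algebra_simps sum.distrib sum_distrib_left)
  also have "real n * (70 * (real r * ln R)) \<le> 70 * (real n * (R * ln R))"
  proof -
    have "real r * ln R \<le> R * ln R" using \<open>real r \<le> R\<close> lnR3 by (intro mult_right_mono) auto
    then have "real n * (real r * ln R) \<le> real n * (R * ln R)" by (rule mult_left_mono) simp
    then show ?thesis by linarith
  qed
  finally show ?thesis unfolding R_def .
qed

lemma wp_solve:
  assumes "matroid V I\<^sub>1" "matroid V I\<^sub>2" "\<epsilon> > 0"
    and J: "J \<in> I\<^sub>1" "J \<in> I\<^sub>2" and max: "\<And>A. A \<in> I\<^sub>1 \<Longrightarrow> A \<in> I\<^sub>2 \<Longrightarrow> card A \<le> card J"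
  shows "wp V (\<lambda>i S. S \<in> (if i then I\<^sub>1 else I\<^sub>2)) (solve V \<epsilon>) 0 (\<lambda>S c. S \<in> I\<^sub>1 \<inter> I\<^sub>2 \<and>
    (1 - \<epsilon>) * real (card J) \<le> real (card S) \<and> real c \<le> 210 * query_bound (card V) (card J) \<epsilon>)"
proof -
  interpret two_matroids V I\<^sub>1 I\<^sub>2 using assms by unfold_locales
  let ?n = "card V" and ?r = "card J"
  define R' where "R' = real (max 2 ?r)"
  define Q where "Q = (\<lambda>S c. S \<in> I\<^sub>1 \<inter> I\<^sub>2 \<and> (1 - \<epsilon>) * real ?r \<le> real (card S) \<and>
    real c \<le> 210 * (real ?n * sqrt (R' * ln R') / \<epsilon>))"
  have ln2: "2 / 3 \<le> ln (2::real)" by (rule ln2_ge_two_thirds)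
  have "2 \<le> R'" unfolding R'_def by simp
  then have "ln 2 \<le> ln R'" by simp
  then have "2 / 3 \<le> ln R'" using ln2 by linarith
  then have "2 * (2 / 3) \<le> R' * ln R'" using \<open>2 \<le> R'\<close> by (intro mult_mono) auto
  then have RlnR: "1 \<le> R' * ln R'" by simp
  then have sqrt1: "1 \<le> sqrt (R' * ln R')" by simp
  have orc: "(\<lambda>i S. S \<in> (if i then I\<^sub>1 else I\<^sub>2)) = query" by (intro ext) (simp add: query_def)
  have "wp V query (solve V \<epsilon>) 0 Q"
  proof (cases "\<epsilon> \<ge> 1")
    case True
    \<comment> \<open>For large \<open>\<epsilon>\<close> the budget may be below \<open>n\<close>,
      so not even the greedy scan is affordable; the empty set is good enough.\<close>
    then have "(1 - \<epsilon>) * real ?r \<le> 0" by (intro mult_nonpos_nonneg) auto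
    then show ?thesis using True assms(3) sqrt1 by (simp add: solve_def Q_def)
  next
    case False
    define S where "S = select (\<lambda>A x. insert x A \<in> I\<^sub>1 \<and> insert x A \<in> I\<^sub>2) (list_by (\<lambda>_. 0) V) {}"
    note S = maximal_common_indep[folded S_def]
    define s where "s = card S"
    define R where "R = real (max 2 s)"
    have sr: "s \<le> ?r" "?r \<le> 2 * s" unfolding s_def using max[OF S(1,2)] S(3)[OF J] by auto
    \<comment> \<open>Weak duality leaves an error of at most \<open>d + card A / k\<close>, and
      each part is at most \<open>\<epsilon> r / 2\<close>. \<open>N\<close> divides the initial
      potential bound \<open>2 * k * (2 * s)\<close> by the drop \<open>d + 1\<close> per
      round.\<close>
    define k where "k = nat \<lceil>2 / \<epsilon>\<rceil>"
    define d where "d = nat \<lfloor>\<epsilon> * real s / 2\<rfloor>"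
    define N where "N = 4 * k * s div (d + 1) + 1"
    define j where "j = nat \<lceil>log 2 (2 * real s)\<rceil>"
    let ?rest = "if s = 0 then Return {} else if 1 \<le> \<epsilon> * sqrt (R * ln R)
        then trunc (2 * s) (auction V k d N {} (\<lambda>_. 0)) else intersect V j (2 * s + 1) S"
    have n_le: "real ?n \<le> real ?n * sqrt (R' * ln R') / \<epsilon>"
    proof -
      have "real ?n * 1 \<le> real ?n * (sqrt (R' * ln R') / \<epsilon>)"
        using False assms(3) sqrt1 by (intro mult_left_mono) (simp_all add: le_divide_eq del: real_sqrt_ge_1_iff)
      then show ?thesis by simp
    qed
    have rest: "wp V query ?rest c Q" if c: "c \<le> 2 * ?n" for c
    proof -
      consider "s = 0" | "s \<noteq> 0" "1 \<le> \<epsilon> * sqrt (R * ln R)" | "s \<noteq> 0" "\<not> 1 \<le> \<epsilon> * sqrt (R * ln R)" by blast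
      then show ?thesis
      proof cases
        case 1
        then have "?r = 0" using sr by simp
        then have "Q {} c" using c n_le unfolding Q_def by simp
        then show ?thesis using 1 by simp
      next
        case 2
        let ?T = "\<lambda>I. {A \<in> I. card A \<le> 2 * s}"
        interpret T: two_matroids V "?T I\<^sub>1" "?T I\<^sub>2"
          by unfold_locales (rule matroid_truncation[OF assms(1)], rule matroid_truncation[OF assms(2)])
        have query: "T.query = (\<lambda>i A. query i A \<and> card A \<le> 2 * s)"
          by (intro ext) (auto simp: T.query_def query_def)
        have "2 / \<epsilon> \<le> real k" unfolding k_def by (rule real_nat_ceiling_ge)
        moreover have "0 < 2 / \<epsilon>" using assms(3) by simp
        ultimately have k_pos: "0 < real k" and k_ge: "2 / \<epsilon> \<le> real k" by linarith+
        have "1 \<le> 1 / \<epsilon>" using False assms(3) by simp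
        have k_le: "real k \<le> 3 / \<epsilon>"
        proof -
          have "real k \<le> 2 / \<epsilon> + 1" unfolding k_def using assms(3) of_int_ceiling_le_add_one[of "2 / \<epsilon>"] by simp
          then show ?thesis using \<open>1 \<le> 1 / \<epsilon>\<close> by (simp add: field_simps)
        qed
        have "real d = of_int \<lfloor>\<epsilon> * real s / 2\<rfloor>" unfolding d_def using assms(3) by simp
        then have d: "real d \<le> \<epsilon> * s / 2" "\<epsilon> * s / 2 \<le> real d + 1" by linarith+
        \<comment> \<open>\<open>d + 1 \<ge> \<epsilon> s / 2\<close> and
          \<open>k \<le> 3 / \<epsilon>\<close> give \<open>24 / \<epsilon>^2\<close>; the
          additional round is absorbed by \<open>\<epsilon> < 1\<close>.\<close>
        have N_le: "real N \<le> 25 / \<epsilon>\<^sup>2"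
        proof -
          have "real (4 * k * s div (d + 1)) \<le> real (4 * k * s) / real (d + 1)" by (rule real_div_le)
          also have "\<dots> \<le> real (4 * k * s) / (\<epsilon> * s / 2)"
            using d(2) 2 assms(3) by (intro divide_left_mono) auto
          also have "\<dots> = 8 * real k / \<epsilon>" using 2 by (simp add: field_simps)
          also have "\<dots> \<le> 8 * (3 / \<epsilon>) / \<epsilon>" using k_le assms(3) by (intro divide_right_mono) auto
          finally have "real N \<le> 24 / \<epsilon>\<^sup>2 + 1" unfolding N_def by (simp add: power2_eq_square)
          moreover have "1 \<le> 1 / \<epsilon>\<^sup>2" using False assms(3) by (simp add: power_le_one)
          ultimately show ?thesis by simp
        qed
        have "wp V T.query (auction V k d N {} (\<lambda>_. 0)) c Q"
        proof (rule T.wp_auction[OF T.auction_inv_initial, where m = "2 * s"])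
          have "T.potential (2 * s) k {} (\<lambda>_. 0) \<le> 2 * k * (2 * s)" by (rule T.potential_initial) simp
          also have "\<dots> = 4 * k * s" by simp
          also have "\<dots> < N * (d + 1)"
            unfolding N_def using dividend_less_div_times[of "d + 1" "4 * k * s"] by (simp add: algebra_simps)
          finally show "T.potential (2 * s) k {} (\<lambda>_. 0) < N * (d + 1)" .
        next
          show "card J \<le> 2 * s" if "J \<in> ?T I\<^sub>2" for J using that by simp
        next
          fix A c' assume A: "A \<in> ?T I\<^sub>1" "A \<in> ?T I\<^sub>2"
            and opt: "\<And>J. J \<in> ?T I\<^sub>1 \<Longrightarrow> J \<in> ?T I\<^sub>2 \<Longrightarrow> k * card J \<le> k * (card A + d) + card A"
            and c': "c' \<le> c + N * (8 * ?n)"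
          have Ar: "card A \<le> ?r" using A max by simp
          have "k * ?r \<le> k * (card A + d) + card A" using opt J sr by simp
          then have "real (k * ?r) \<le> real (k * (card A + d) + card A)" unfolding of_nat_le_iff .
          then have "real k * (real ?r - real (card A) - real d) \<le> real (card A)" by (simp add: algebra_simps)
          also have "\<dots> \<le> real k * (\<epsilon> * real ?r / 2)"
          proof -
            have "2 / \<epsilon> * (\<epsilon> * real ?r / 2) \<le> real k * (\<epsilon> * real ?r / 2)"
              using k_ge assms(3) by (intro mult_right_mono) auto
            then show ?thesis using Ar assms(3) by simp
          qed
          finally have "real ?r - real (card A) - real d \<le> \<epsilon> * real ?r / 2"
            by (rule mult_left_le_imp_le[OF _ k_pos])
          moreover have "\<epsilon> * real s \<le> \<epsilon> * real ?r" using sr(1) assms(3) by (intro mult_left_mono) auto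
          then have "real d \<le> \<epsilon> * real ?r / 2" using d(1) by linarith
          ultimately have approx: "(1 - \<epsilon>) * real ?r \<le> real (card A)" by (simp add: algebra_simps)
          have "R * ln R \<le> R' * ln R'"
            using sr(1) ln2 unfolding R_def R'_def by (intro mult_mono) auto
          then have "sqrt (R * ln R) \<le> sqrt (R' * ln R')" by (rule real_sqrt_le_mono)
          then have "\<epsilon> * sqrt (R * ln R) \<le> \<epsilon> * sqrt (R' * ln R')" using assms(3) by (intro mult_left_mono) auto
          then have "1 \<le> sqrt (R' * ln R') * \<epsilon>" using 2(2) by (subst mult.commute) linarith
          then have inv_eps: "1 / \<epsilon> \<le> sqrt (R' * ln R')" by (simp only: pos_divide_le_eq[OF assms(3)])
          have "real c' \<le> real (2 * ?n + N * (8 * ?n))" unfolding of_nat_le_iff using c' c by simp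
          also have "\<dots> = 2 * real ?n + 8 * real ?n * real N" by simp
          also have "\<dots> \<le> 2 * real ?n + 8 * real ?n * (25 / \<epsilon>\<^sup>2)"
            using N_le by (intro add_left_mono mult_left_mono) auto
          also have "8 * real ?n * (25 / \<epsilon>\<^sup>2) = 200 * (real ?n * (1 / \<epsilon>) / \<epsilon>)" by (simp add: power2_eq_square)
          finally have "real c' \<le> 2 * real ?n + 200 * (real ?n * (1 / \<epsilon>) / \<epsilon>)" .
          moreover have "real ?n * (1 / \<epsilon>) / \<epsilon> \<le> real ?n * sqrt (R' * ln R') / \<epsilon>"
            using inv_eps assms(3) by (intro divide_right_mono mult_left_mono) auto
          \<comment> \<open>The constant is \<open>2 + 200\<close> here and \<open>2 + 140\<close>
            in the other branch; \<open>210\<close> covers both.\<close>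
          ultimately have "real c' \<le> 210 * (real ?n * sqrt (R' * ln R') / \<epsilon>)" using n_le by linarith
          then show "Q A c'" using A approx unfolding Q_def by simp
        qed
        then show ?thesis using 2 by (simp add: wp_trunc query)
      next
        case 3
        have s1: "1 \<le> s" "1 \<le> ?r" using 3 sr by auto
        have R2: "2 \<le> R" unfolding R_def by simp
        then have lnR: "ln 2 \<le> ln R" by simp
        then have lnR0: "0 \<le> ln R" using ln2 by linarith
        \<comment> \<open>The branch was chosen by \<open>s\<close>, the bound speaks of
          \<open>r\<close>. They differ by a factor of at most two, which at most doubles the square
          root.\<close>
        have "R' \<le> 2 * R" using sr unfolding R_def R'_def by auto
        then have "ln R' \<le> ln (2 * R)" using \<open>2 \<le> R'\<close> by simp
        also have "\<dots> = ln 2 + ln R" using R2 by (simp add: ln_mult)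
        finally have "ln R' \<le> 2 * ln R" using lnR by simp
        then have "R' * ln R' \<le> (2 * R) * (2 * ln R)"
          using \<open>R' \<le> 2 * R\<close> \<open>2 \<le> R'\<close> R2 lnR0 by (intro mult_mono) auto
        then have "sqrt (R' * ln R') \<le> sqrt (4 * (R * ln R))" by simp
        also have "\<dots> = 2 * sqrt (R * ln R)" by (simp add: real_sqrt_mult)
        also have "\<dots> \<le> 2 * (1 / \<epsilon>)" using 3 assms(3) by (simp add: field_simps)
        finally have sqrt_le: "sqrt (R' * ln R') \<le> 2 / \<epsilon>" by simp
        have "real ?n * (R' * ln R') = real ?n * sqrt (R' * ln R') * sqrt (R' * ln R')"
          using RlnR by simp
        also have "\<dots> \<le> real ?n * sqrt (R' * ln R') * (2 / \<epsilon>)"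
          using sqrt_le sqrt1 by (intro mult_left_mono) auto
        finally have bound: "real ?n * (R' * ln R') \<le> 2 * (real ?n * sqrt (R' * ln R') / \<epsilon>)"
          by (simp add: mult_ac)
        have "wp V query (intersect V j (2 * s + 1) S) c Q"
        proof (rule wp_intersect[OF J max])
          have "real ?r \<le> 2 powr log 2 (2 * real s)" using sr s1 by simp
          also have "\<dots> \<le> 2 powr real j" unfolding j_def using s1 by (intro powr_mono) auto
          finally have "real ?r \<le> real (2 ^ j)" by (simp add: powr_realpow)
          then show "?r \<le> 2 ^ j" unfolding of_nat_le_iff .
          show "?r - card S < 2 * s + 1" using sr by simp
          fix A c' assume A: "A \<in> I\<^sub>1" "A \<in> I\<^sub>2" "card A = ?r"
            and c': "c' \<le> c + path_cost ?n j ?r (?r - card S)"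
          have "real c' \<le> real (2 * ?n + path_cost ?n j ?r (?r - card S))"
            unfolding of_nat_le_iff using c' c by simp
          also have "\<dots> = 2 * real ?n + real (path_cost ?n j ?r (?r - card S))" by simp
          also have "\<dots> \<le> 2 * real ?n + 70 * (real ?n * (R' * ln R'))"
            unfolding R'_def using s1 sr by (intro add_left_mono path_cost_le[where s = s]) (auto simp: j_def)
          also have "\<dots> \<le> 210 * (real ?n * sqrt (R' * ln R') / \<epsilon>)" proof -
            have "2 * N + 70 * X \<le> 210 * B" if "X \<le> 2 * B" "N \<le> B" "0 \<le> N" for N X B :: real
              using that by linarith
            then show ?thesis using bound n_le of_nat_0_le_iff by blast
          qed
          finally have "real c' \<le> 210 * (real ?n * sqrt (R' * ln R') / \<epsilon>)" .
          moreover have "(1 - \<epsilon>) * real ?r \<le> 1 * real ?r" using assms(3) by (intro mult_right_mono) auto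
          ultimately show "Q A c'" using A unfolding Q_def by simp
        qed (use S in auto)
        then show ?thesis using 3 by simp
      qed
    qed
    have "wp V query (bind (scan (\<lambda>A x. insert x A) (\<lambda>A x. insert x A) (list_by (\<lambda>_. 0) V) {}) (\<lambda>S.
     let s = card S; R = real (max 2 s) in
     if s = 0 then Return {}
     else if \<epsilon> * sqrt (R * ln R) \<ge> 1 then
       (let k = nat \<lceil>2 / \<epsilon>\<rceil>; d = nat \<lfloor>\<epsilon> * real s / 2\<rfloor>
        in trunc (2 * s) (auction V k d (4 * k * s div (d + 1) + 1) {} (\<lambda>_. 0)))
     else intersect V (nat \<lceil>log 2 (2 * real s)\<rceil>) (2 * s + 1) S)) 0 Q"
    proof (rule wp_scan_bind[where R = S and l = ?n])
      fix c' assume "c' \<le> 0 + 2 * ?n"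
      then have "wp V query ?rest c' Q" using rest by simp
      then show "wp V query (let s = card S; R = real (max 2 s) in
         if s = 0 then Return {}
         else if \<epsilon> * sqrt (R * ln R) \<ge> 1 then
           (let k = nat \<lceil>2 / \<epsilon>\<rceil>; d = nat \<lfloor>\<epsilon> * real s / 2\<rfloor>
            in trunc (2 * s) (auction V k d (4 * k * s div (d + 1) + 1) {} (\<lambda>_. 0)))
         else intersect V (nat \<lceil>log 2 (2 * real s)\<rceil>) (2 * s + 1) S) c' Q"
        unfolding Let_def s_def R_def k_def d_def N_def j_def .
    qed (use list_by[OF M1.finite_V] in \<open>auto simp: S_def\<close>)
    then show ?thesis using False by (simp only: solve_def if_False)
  qed
  then show ?thesis unfolding orc Q_def query_bound_def R'_def .
qed

theorem theorem1:
  "\<exists>(alg :: 'a set \<Rightarrow> real \<Rightarrow> 'a query_tree) (C :: real). C > 0 \<and>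
     (\<forall>V \<I>\<^sub>1 \<I>\<^sub>2 \<epsilon>. matroid V \<I>\<^sub>1 \<longrightarrow> matroid V \<I>\<^sub>2 \<longrightarrow> \<epsilon> > 0 \<longrightarrow>
        queries_within V (alg V \<epsilon>) \<and>
        run \<I>\<^sub>1 \<I>\<^sub>2 (alg V \<epsilon>) \<in> \<I>\<^sub>1 \<inter> \<I>\<^sub>2 \<and>
        real (card (run \<I>\<^sub>1 \<I>\<^sub>2 (alg V \<epsilon>))) \<ge> (1 - \<epsilon>) * real (max_common_indep \<I>\<^sub>1 \<I>\<^sub>2) \<and>
        real (num_queries \<I>\<^sub>1 \<I>\<^sub>2 (alg V \<epsilon>))
          \<le> C * query_bound (card V) (max_common_indep \<I>\<^sub>1 \<I>\<^sub>2) \<epsilon>)"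
proof (intro exI conjI allI impI)
  show "(210::real) > 0" by simp
  fix V :: "'a set" and I\<^sub>1 I\<^sub>2 and \<epsilon> :: real
  assume m: "matroid V I\<^sub>1" "matroid V I\<^sub>2" "\<epsilon> > 0"
  interpret two_matroids V I\<^sub>1 I\<^sub>2 using m by unfold_locales
  let ?t = "to_tree V (solve V \<epsilon>)"
  show "queries_within V ?t" by (rule queries_within_to_tree)
  have fin: "finite (card ` (I\<^sub>1 \<inter> I\<^sub>2))" using M1.finite_I by simp
  have "I\<^sub>1 \<inter> I\<^sub>2 \<noteq> {}" using M1.indep_empty M2.indep_empty by blast
  then have "Max (card ` (I\<^sub>1 \<inter> I\<^sub>2)) \<in> card ` (I\<^sub>1 \<inter> I\<^sub>2)" using fin by (intro Max_in) auto
  then obtain J where J: "J \<in> I\<^sub>1" "J \<in> I\<^sub>2" "card J = max_common_indep I\<^sub>1 I\<^sub>2"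
    unfolding max_common_indep_def by auto
  have "card A \<le> card J" if "A \<in> I\<^sub>1" "A \<in> I\<^sub>2" for A
    unfolding J(3) max_common_indep_def using that fin by (intro Max_ge) auto
  note result = wp_to_tree[OF wp_solve[OF m J(1,2) this], simplified J(3)]
  from result show "run I\<^sub>1 I\<^sub>2 ?t \<in> I\<^sub>1 \<inter> I\<^sub>2"
    and "real (card (run I\<^sub>1 I\<^sub>2 ?t)) \<ge> (1 - \<epsilon>) * real (max_common_indep I\<^sub>1 I\<^sub>2)"
    and "real (num_queries I\<^sub>1 I\<^sub>2 ?t) \<le> 210 * query_bound (card V) (max_common_indep I\<^sub>1 I\<^sub>2) \<epsilon>"
    by auto
qed

end
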